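(* For every $a\in[0,\frac{\pi}{4}]$ there exists a sequence $(n_i)_{i\ge1}$ of elements of $S$ (equivalently, a sequence of energy levels $E_{n_i}=4\pi^2 n_i$) such that $\mu_{n_i}\Rightarrow\nu_a$ as $i\to\infty$. In particular, for every $b\in[0,1]$ there exists a sequence $(n_i)_{i\ge 1}$ of elements of $S$ such that $$c_{n_i}\to\frac{1+b}{512}.$$
   Context: $S=\{n\ge 1: n=a^2+b^2,\ a,b\in\mathbb{Z}\}$. For $n\in S$: $\Lambda_n=\{\lambda\in\mathbb{Z}^2:\|\lambda\|^2=n\}$, $\mathcal{N}_n=|\Lambda_n|$. Identify $\mathbb{R}^2\cong\mathbb{C}$, $\mathcal{S}^1=\{z\in\mathbb{C}:|z|=1\}$. Let $\mu_n=\frac{1}{\mathcal{N}_n}\sum_{\lambda\in\Lambda_n}\delta_{\lambda/\sqrt{n}}$, a probability measure on $\mathcal{S}^1$, $\widehat{\mu}_n(k)=\int_{\mathcal{S}^1}z^{-k}\,d\mu_n(z)$ for $k\in\mathbb{Z}$, and $c_n=\frac{1+\widehat{\mu}_n(4)^2}{512}$ ($\widehat\mu_n(4)$ is real). For $a\in(0,\frac\pi4]$, $\nu_a$ is the probability measure on $\mathcal{S}^1$ given by $$\int f\,d\nu_a=\frac{1}{8a}\sum_{k=0}^{3}\int_{-a+k\pi/2}^{a+k\pi/2}f(e^{i\theta})\,d\theta,$$ and $\nu_0=\frac14\sum_{k=0}^3\delta_{i^k}$. The symbol $\Rightarrow$ denotes weak convergence of probability measures on $\mathcal{S}^1$. 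*)

theory Defs
  imports "HOL-Probability.Probability"
begin

definition sums_of_two_squares :: "nat set" where
  "sums_of_two_squares = {n. n \<ge> 1 \<and> (\<exists>a b :: int. int n = a\<^sup>2 + b\<^sup>2)}"

definition lattice_points :: "nat \<Rightarrow> (int \<times> int) set" where
  "lattice_points n = {(x, y). x\<^sup>2 + y\<^sup>2 = int n}"

definition circle_borel :: "complex measure" where
  "circle_borel = restrict_space borel (sphere 0 1)"

definition lattice_measure :: "nat \<Rightarrow> complex measure" where
  "lattice_measure n =
     distr (uniform_count_measure (lattice_points n)) circle_borel
       (\<lambda>(x, y). Complex (of_int x) (of_int y) / of_real (sqrt (real n)))"

text \<open>
  For \<open>a > 0\<close> this is the image under \<open>\<theta> \<mapsto> e^(i\<theta>)\<close> of the sum over \<open>k < 4\<close> of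
  Lebesgue measure on \<open>[-a + k\<pi>/2, a + k\<pi>/2]\<close>, divided by \<open>8a\<close>; the defining integral formula
  is \<open>integral_arc_measure\<close> below.
\<close>

definition arc_measure :: "real \<Rightarrow> complex measure" where
  "arc_measure a =
     (if a = 0 then distr (uniform_count_measure {..<4::nat}) circle_borel (\<lambda>k. \<i> ^ k)
      else distr
        (density lborel (\<lambda>\<theta>. ennreal (1 / (8 * a) *
           (\<Sum>k<4::nat. indicator {- a + real k * pi / 2 .. a + real k * pi / 2} \<theta>))))
        circle_borel cis)"

text \<open>
  Weak convergence of measures on the unit circle. Boundedness of the test function is automatic
  by compactness. The library's \<open>weak_conv_m\<close> only covers measures on the real line.
\<close>

definition circle_weak_conv :: "(nat \<Rightarrow> complex measure) \<Rightarrow> complex measure \<Rightarrow> bool" where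
  "circle_weak_conv M N \<longleftrightarrow>
     (\<forall>f :: complex \<Rightarrow> real. continuous_on (sphere 0 1) f \<longrightarrow>
        (\<lambda>i. \<integral>z. f z \<partial>(M i)) \<longlonglongrightarrow> (\<integral>z. f z \<partial>N))"

definition fourier_coeff :: "complex measure \<Rightarrow> int \<Rightarrow> complex" where
  "fourier_coeff M k = (\<integral>z. z powi (- k) \<partial>M)"

text \<open>Taking the real part loses nothing, by \<open>fourier_coeff_lattice_measure_4_real\<close> below.\<close>

definition leading_const :: "nat \<Rightarrow> real" where
  "leading_const n = (1 + (Re (fourier_coeff (lattice_measure n) 4))\<^sup>2) / 512"

lemma finite_lattice_points: "finite (lattice_points n)"
proof (rule finite_subset)
  have "\<bar>x\<bar> \<le> int n" if "x\<^sup>2 + y\<^sup>2 = int n" for x y :: int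
  proof -
    have "0 \<le> \<bar>x\<bar> * (\<bar>x\<bar> - 1)"
      by (cases "x = 0") simp_all
    then have "\<bar>x\<bar> \<le> x\<^sup>2"
      by (simp add: power2_eq_square algebra_simps)
    moreover have "0 \<le> y\<^sup>2"
      by simp
    ultimately show ?thesis
      using that by linarith
  qed
  from this this[of y x for x y]
  show "lattice_points n \<subseteq> {- int n..int n} \<times> {- int n..int n}"
    by (fastforce simp: lattice_points_def abs_le_iff add.commute)
qed simp

lemma lattice_points_nonempty: "n \<in> sums_of_two_squares \<Longrightarrow> lattice_points n \<noteq> {}"
  by (fastforce simp: sums_of_two_squares_def lattice_points_def)

lemma lattice_map_measurable:
  assumes "n \<in> sums_of_two_squares"
  shows "(\<lambda>(x, y). Complex (of_int x) (of_int y) / of_real (sqrt (real n)))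
     \<in> measurable (uniform_count_measure (lattice_points n)) circle_borel"
proof -
  have n: "n \<ge> 1"
    using assms by (simp add: sums_of_two_squares_def)
  have "norm (Complex (of_int x) (of_int y) / of_real (sqrt (real n))) = 1"
    if "x\<^sup>2 + y\<^sup>2 = int n" for x y
  proof -
    have "(real_of_int x)\<^sup>2 + (real_of_int y)\<^sup>2 = real n"
      using that by (metis of_int_add of_int_of_nat_eq of_int_power)
    then show ?thesis
      using n by (simp add: norm_divide complex_norm)
  qed
  then show ?thesis
    by (auto simp: measurable_def space_uniform_count_measure sets_uniform_count_measure
        circle_borel_def space_restrict_space lattice_points_def)
qed

lemma cis_measurable [measurable]: "cis \<in> measurable borel circle_borel"
  unfolding circle_borel_def
  by (rule measurable_restrict_space2)
     (auto intro!: borel_measurable_continuous_onI continuous_intros)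

lemma prob_space_lattice_measure:
  assumes "n \<in> sums_of_two_squares"
  shows "prob_space (lattice_measure n)"
  unfolding lattice_measure_def using assms
  by (intro prob_space.prob_space_distr prob_space_uniform_count_measure lattice_map_measurable
      finite_lattice_points lattice_points_nonempty)

lemma integral_lattice_measure:
  fixes f :: "complex \<Rightarrow> 'b :: {banach, second_countable_topology}"
  assumes "n \<in> sums_of_two_squares" and "f \<in> borel_measurable circle_borel"
  shows "(\<integral>z. f z \<partial>(lattice_measure n)) =
    (\<Sum>(x, y)\<in>lattice_points n. f (Complex (of_int x) (of_int y) / of_real (sqrt (real n))))
      /\<^sub>R real (card (lattice_points n))"
  unfolding lattice_measure_def
  by (subst integral_distr[OF lattice_map_measurable[OF assms(1)] assms(2)])
     (simp add: uniform_count_measure_def lebesgue_integral_point_measure_finite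
        finite_lattice_points scaleR_sum_right case_prod_unfold divide_inverse)

lemma integral_arc_measure_0:
  fixes f :: "complex \<Rightarrow> 'b :: {banach, second_countable_topology}"
  assumes "f \<in> borel_measurable circle_borel"
  shows "(\<integral>z. f z \<partial>(arc_measure 0)) = (\<Sum>k<4::nat. f (\<i> ^ k)) /\<^sub>R 4"
proof -
  have "(\<lambda>k. \<i> ^ k) \<in> measurable (uniform_count_measure {..<4::nat}) circle_borel"
    by (auto simp: measurable_def space_uniform_count_measure sets_uniform_count_measure
        circle_borel_def space_restrict_space norm_power)
  from integral_distr[OF this assms] show ?thesis
    by (simp add: arc_measure_def uniform_count_measure_def
        lebesgue_integral_point_measure_finite scaleR_sum_right)
qed

lemma integral_arc_measure:
  fixes f :: "complex \<Rightarrow> real"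
  assumes "a > 0" and "continuous_on (sphere 0 1) f"
  shows "(\<integral>z. f z \<partial>(arc_measure a)) =
    1 / (8 * a) * (\<Sum>k<4::nat.
      integral {- a + real k * pi / 2 .. a + real k * pi / 2} (\<lambda>\<theta>. f (cis \<theta>)))"
proof -
  define A where "A = (\<lambda>k::nat. {- a + real k * pi / 2 .. a + real k * pi / 2})"
  have [measurable]: "A k \<in> sets borel" for k
    by (simp add: A_def)
  have f: "f \<in> borel_measurable circle_borel"
    unfolding circle_borel_def using assms(2) by (rule borel_measurable_continuous_on_restrict)
  have cont: "continuous_on X (\<lambda>\<theta>. f (cis \<theta>))" for X
    by (rule continuous_on_compose2[OF assms(2)]) (auto intro!: continuous_intros)
  have meas [measurable]: "(\<lambda>\<theta>. f (cis \<theta>)) \<in> borel_measurable borel"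
    using cont[of UNIV] by (rule borel_measurable_continuous_onI)
  have int: "set_integrable lborel (A k) (\<lambda>\<theta>. f (cis \<theta>))" for k
    unfolding A_def by (rule borel_integrable_atLeastAtMost') (rule cont)
  have "(\<integral>z. f z \<partial>(arc_measure a)) =
      (\<integral>\<theta>. f (cis \<theta>) \<partial>(density lborel
         (\<lambda>\<theta>. ennreal (1 / (8 * a) * (\<Sum>k<4::nat. indicator (A k) \<theta>)))))"
    using assms(1) unfolding arc_measure_def A_def by (simp add: integral_distr f)
  also have "\<dots> = (\<integral>\<theta>. (1 / (8 * a) * (\<Sum>k<4::nat. indicator (A k) \<theta>)) *\<^sub>R f (cis \<theta>) \<partial>lborel)"
    using assms(1) by (intro integral_density) (auto intro!: AE_I2 divide_nonneg_nonneg sum_nonneg)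
  also have "\<dots> = (\<integral>\<theta>. 1 / (8 * a) * (\<Sum>k<4::nat. indicator (A k) \<theta> *\<^sub>R f (cis \<theta>)) \<partial>lborel)"
    by (simp add: sum_distrib_right mult.assoc)
  also have "\<dots> = 1 / (8 * a) * (\<Sum>k<4::nat. (LINT \<theta>:A k|lborel. f (cis \<theta>)))"
    using int unfolding set_lebesgue_integral_def set_integrable_def
    by (subst integral_mult_right_zero) (simp only: Bochner_Integration.integral_sum)
  finally show ?thesis
    using set_borel_integral_eq_integral(2)[OF int] by (simp add: A_def)
qed

lemma prob_space_arc_measure:
  assumes "a \<ge> 0"
  shows "prob_space (arc_measure a)"
proof (cases "a = 0")
  case True
  have "(\<lambda>k. \<i> ^ k) \<in> measurable (uniform_count_measure {..<4::nat}) circle_borel"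
    by (auto simp: measurable_def space_uniform_count_measure sets_uniform_count_measure
        circle_borel_def space_restrict_space norm_power)
  then show ?thesis
    unfolding arc_measure_def using True
    by (auto intro!: prob_space.prob_space_distr prob_space_uniform_count_measure
        simp: lessThan_empty_iff)
next
  case False
  with assms have a: "a > 0"
    by simp
  have "measure (arc_measure a) (space (arc_measure a)) = (\<integral>z. 1 \<partial>(arc_measure a))"
    by simp
  also have "\<dots> = 1"
    using a by (subst integral_arc_measure) auto
  finally show ?thesis
    by (metis emeasure_eq_ennreal_measure ennreal_1 measure_zero_top prob_spaceI zero_neq_one)
qed

lemma fourier_coeff_lattice_measure_4_real:
  assumes "n \<in> sums_of_two_squares"
  shows "fourier_coeff (lattice_measure n) 4 \<in> \<real>"
proof -
  define g where
    "g = (\<lambda>(x, y). Complex (of_int x) (of_int y) / complex_of_real (sqrt (real n)))"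
  define h where "h = (\<lambda>p. g p powi (- 4))"
  have meas: "(\<lambda>z. z powi (- 4)) \<in> borel_measurable circle_borel"
    unfolding circle_borel_def
    by (rule borel_measurable_continuous_on_restrict) (auto intro!: continuous_intros)
  have cnj: "cnj (h (x, y)) = h (x, - y)" for x y
  proof -
    have "cnj (g (x, y)) = g (x, - y)"
      by (simp add: g_def complex_eq_iff)
    then show ?thesis
      by (simp add: h_def power_int_minus)
  qed
  have "cnj (\<Sum>p\<in>lattice_points n. h p) = (\<Sum>p\<in>lattice_points n. h (fst p, - snd p))"
    using cnj by (simp add: cnj_sum) (metis prod.collapse)
  also have "\<dots> = (\<Sum>p\<in>lattice_points n. h p)"
    by (rule sum.reindex_bij_witness[of _ "\<lambda>p. (fst p, - snd p)" "\<lambda>p. (fst p, - snd p)"])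
       (auto simp: lattice_points_def)
  finally have "(\<Sum>p\<in>lattice_points n. h p) \<in> \<real>"
    by (simp add: Reals_cnj_iff)
  then show ?thesis
    unfolding fourier_coeff_def integral_lattice_measure[OF assms meas]
    by (simp add: h_def g_def case_prod_unfold scaleR_conv_of_real)
qed

end

theory Submission
  imports Defs "HOL-Computational_Algebra.Primes" "HOL-Real_Asymp.Real_Asymp"
begin

text \<open>
  If \<open>p = \<pi> \<pi>'\<close> with \<open>\<pi> = sqrt p e^(i\<theta>)\<close> a Gaussian prime and \<open>\<pi>'\<close> its conjugate, then the points of norm
  \<open>p^k\<close> are \<open>i^l \<pi>^j \<pi>'^(k-j)\<close>, with arguments \<open>(2j-k)\<theta> + l\<pi>/2\<close>. Hence if \<open>\<theta>\<close> tends to \<open>0\<close> and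
  \<open>k = floor(a/\<theta>)\<close>, these points equidistribute on the four arcs of half-length \<open>a\<close>, and it only remains to
  find Gaussian primes of arbitrarily small positive argument.

  Consider the Hecke sums \<open>L(k,s) = \<Sum> (z/|z|)^(4k) |z|^(-2s)\<close> over nonzero Gaussian integers. For \<open>k = 0\<close> they
  are unbounded as \<open>s\<close> decreases to \<open>1\<close>. For \<open>k > 0\<close> they stay bounded: splitting the Gaussian integers into
  residue classes modulo \<open>\<alpha> = 2 + i\<close> gives \<open>L (1 - 5 (\<alpha>/|\<alpha>|)^(4k) 5^(-s)) = O(1)\<close>, and \<open>(\<alpha>/|\<alpha>|)^(4k)\<close> is
  not real. By the Euler product, the sums of \<open>cos(4k\<theta>) p^(-s)\<close> over split primes are bounded above for each
  \<open>k > 0\<close> and unbounded for \<open>k = 0\<close>. Upper bounds suffice, so no nonvanishing at \<open>s = 1\<close> is needed: some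
  trigonometric polynomial in \<open>4\<theta>\<close> with positive mean and all other coefficients nonpositive is negative
  outside any given neighbourhood of \<open>\<theta> = 0\<close>, which rules out that all primes avoid this neighbourhood.
\<close>

section \<open>Gaussian integers and their primes\<close>

text \<open>Near s = 1 the logarithm of a Hecke sum with k > 0 is bounded above but might tend to
  minus infinity. So its prime sums are controlled from one side only, and a general bump function,
  whose coefficients may have either sign, cannot be tested against them. This dictates the shape of
  the trigonometric polynomial: a difference of two normalized powers of 2 + 2 cos(4 theta), since
  the coefficients of such powers are nonnegative and tend to 1 as the exponent grows. The modulus 2
  + i is chosen because 0 and the four units represent all its classes and its argument is not a
  rational multiple of pi. For k = 0 the factor 1 - 5 * 5^(-s) tends to 0, so the same argument
  leaves room for a pole. The Euler product appears in finite form: at fixed s, sieving by the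
  primes up to a large X leaves the four units and a tail of absolute value at most 1, hence bounds
  from above and below. The second claim follows from the first: the coefficient of index 4 of the
  arc measure is sin(4a)/(4a), whose square runs continuously from 1 at a = 0 to 0 at a =
  pi/4.\<close>

definition gauss_ints :: "complex set" where
  "gauss_ints = {z. Re z \<in> \<int> \<and> Im z \<in> \<int>}"

text \<open>A value in \<open>nat\<close> makes the library's primes and divisibility available; the
  floor makes the function total on \<open>complex\<close> and is exact on
  \<open>gauss_ints\<close>.\<close>

definition gauss_norm :: "complex \<Rightarrow> nat" where
  "gauss_norm z = nat \<lfloor>(cmod z)\<^sup>2\<rfloor>"

text \<open>Divisibility in the field \<open>complex\<close> is trivial, so the quotient has to be
  confined to \<open>gauss_ints\<close>.\<close>

definition gauss_dvd :: "complex \<Rightarrow> complex \<Rightarrow> bool" where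
  "gauss_dvd d z \<longleftrightarrow> (\<exists>w\<in>gauss_ints. z = d * w)"

lemma gauss_ints_closed [simp, intro]:
  "0 \<in> gauss_ints" "1 \<in> gauss_ints" "\<i> \<in> gauss_ints" "of_nat n \<in> gauss_ints" "of_int m \<in> gauss_ints"
  "z \<in> gauss_ints \<Longrightarrow> w \<in> gauss_ints \<Longrightarrow> z + w \<in> gauss_ints"
  "z \<in> gauss_ints \<Longrightarrow> w \<in> gauss_ints \<Longrightarrow> z - w \<in> gauss_ints"
  "z \<in> gauss_ints \<Longrightarrow> w \<in> gauss_ints \<Longrightarrow> z * w \<in> gauss_ints"
  "z \<in> gauss_ints \<Longrightarrow> - z \<in> gauss_ints"
  "z \<in> gauss_ints \<Longrightarrow> cnj z \<in> gauss_ints"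
  by (auto simp: gauss_ints_def)

lemma gauss_ints_power [simp, intro]: "z \<in> gauss_ints \<Longrightarrow> z ^ n \<in> gauss_ints"
  by (induction n) auto

lemma gauss_intsE:
  assumes "z \<in> gauss_ints"
  obtains x y :: int where "z = Complex (of_int x) (of_int y)"
  using assms by (auto simp: gauss_ints_def complex_eq_iff elim!: Ints_cases)

lemma Complex_of_int_gauss_ints [simp, intro]: "Complex (of_int x) (of_int y) \<in> gauss_ints"
  by (auto simp: gauss_ints_def)

lemma gauss_norm_Complex: "int (gauss_norm (Complex (of_int x) (of_int y))) = x\<^sup>2 + y\<^sup>2"
proof -
  have "(cmod (Complex (of_int x) (of_int y)))\<^sup>2 = of_int (x\<^sup>2 + y\<^sup>2)"
    by (simp add: cmod_power2)
  then show ?thesis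
    unfolding gauss_norm_def by (simp only: floor_of_int) simp
qed

lemma of_nat_gauss_norm: "z \<in> gauss_ints \<Longrightarrow> real (gauss_norm z) = (cmod z)\<^sup>2"
proof (erule gauss_intsE)
  fix x y assume z: "z = Complex (of_int x) (of_int y)"
  have "real (gauss_norm z) = of_int (int (gauss_norm z))"
    by simp
  also have "\<dots> = (cmod z)\<^sup>2"
    unfolding z gauss_norm_Complex by (simp add: cmod_power2)
  finally show "real (gauss_norm z) = (cmod z)\<^sup>2" .
qed

lemma gauss_norm_mult:
  assumes "z \<in> gauss_ints" "w \<in> gauss_ints"
  shows "gauss_norm (z * w) = gauss_norm z * gauss_norm w"
proof -
  have "real (gauss_norm (z * w)) = real (gauss_norm z * gauss_norm w)"
    using assms by (simp add: of_nat_gauss_norm norm_mult power_mult_distrib)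
  then show ?thesis
    by (simp only: of_nat_eq_iff)
qed

lemma gauss_norm_simps [simp]:
  "gauss_norm 0 = 0" "gauss_norm 1 = 1" "gauss_norm (cnj z) = gauss_norm z" "gauss_norm (of_nat n) = n\<^sup>2"
  by (simp_all add: gauss_norm_def flip: of_nat_power)

lemma gauss_norm_power: "z \<in> gauss_ints \<Longrightarrow> gauss_norm (z ^ n) = gauss_norm z ^ n"
  by (induction n) (simp_all add: gauss_norm_mult)

lemma gauss_norm_eq_0_iff: "z \<in> gauss_ints \<Longrightarrow> gauss_norm z = 0 \<longleftrightarrow> z = 0"
  using of_nat_gauss_norm[of z] by auto

lemma mult_cnj_gauss_norm: "z \<in> gauss_ints \<Longrightarrow> z * cnj z = of_nat (gauss_norm z)"
  by (metis complex_norm_square of_nat_gauss_norm of_real_of_nat_eq)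

lemma gauss_norm_less_iff:
  "z \<in> gauss_ints \<Longrightarrow> w \<in> gauss_ints \<Longrightarrow> gauss_norm z < gauss_norm w \<longleftrightarrow> cmod z < cmod w"
  using of_nat_gauss_norm[of z] of_nat_gauss_norm[of w]
  by (metis norm_ge_zero of_nat_less_iff power2_less_imp_less power_strict_mono zero_less_numeral)

lemma gauss_norm_eq_1D:
  assumes "z \<in> gauss_ints" "gauss_norm z = 1"
  shows "z \<in> {1, -1, \<i>, -\<i>}"
proof -
  obtain x y :: int where z: "z = Complex (of_int x) (of_int y)"
    using assms(1) by (rule gauss_intsE)
  have sq: "x\<^sup>2 + y\<^sup>2 = 1"
    using gauss_norm_Complex[of x y] assms(2) z by simp
  have *: "u = 0 \<or> u = 1 \<or> u = -1" if "u\<^sup>2 \<le> 1" for u :: int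
  proof -
    have "\<bar>u\<bar> \<le> \<bar>1\<bar>"
      using that abs_le_square_iff[of u 1] by simp
    then show ?thesis by linarith
  qed
  have "x\<^sup>2 \<le> 1" "y\<^sup>2 \<le> 1"
    using sq zero_le_power2[of x] zero_le_power2[of y] by linarith+
  then have "x = 0 \<or> x = 1 \<or> x = -1" "y = 0 \<or> y = 1 \<or> y = -1"
    using * by blast+
  then show ?thesis
    using sq by (auto simp: z complex_eq_iff)
qed

lemma gauss_norm_pos: "z \<in> gauss_ints \<Longrightarrow> z \<noteq> 0 \<Longrightarrow> gauss_norm z > 0"
  using gauss_norm_eq_0_iff by blast

section \<open>Divisibility and Bezout relations\<close>

lemma gauss_dvd_norm:
  "gauss_dvd d z \<Longrightarrow> d \<in> gauss_ints \<Longrightarrow> gauss_norm d dvd gauss_norm z"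
  by (auto simp: gauss_dvd_def gauss_norm_mult)

lemma gauss_dvd_trans: "gauss_dvd a b \<Longrightarrow> gauss_dvd b c \<Longrightarrow> gauss_dvd a c"
  unfolding gauss_dvd_def by (metis gauss_ints_closed(8) mult.assoc)

lemma gauss_dvd_mult: "gauss_dvd a b \<Longrightarrow> c \<in> gauss_ints \<Longrightarrow> gauss_dvd a (b * c)"
  unfolding gauss_dvd_def by (metis gauss_ints_closed(8) mult.assoc)

lemma gauss_dvd_add: "gauss_dvd a b \<Longrightarrow> gauss_dvd a c \<Longrightarrow> gauss_dvd a (b + c)"
  unfolding gauss_dvd_def by (metis gauss_ints_closed(6) distrib_left)

lemma gauss_dvd_triv: "w \<in> gauss_ints \<Longrightarrow> gauss_dvd a (a * w)"
  by (auto simp: gauss_dvd_def)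

lemma gauss_dvd_cnj: "gauss_dvd a b \<Longrightarrow> gauss_dvd (cnj a) (cnj b)"
  by (auto simp: gauss_dvd_def)

text \<open>The quotient has norm 1, so its conjugate is its inverse and the two elements are
  associates.\<close>

lemma gauss_dvd_same_norm:
  assumes "gauss_dvd d z" "d \<in> gauss_ints" "d \<noteq> 0" "gauss_norm d = gauss_norm z"
  shows "gauss_dvd z d"
proof -
  obtain w where w: "w \<in> gauss_ints" "z = d * w"
    using assms(1) by (auto simp: gauss_dvd_def)
  have "gauss_norm w = 1"
    using assms w by (simp add: gauss_norm_mult gauss_norm_eq_0_iff)
  then have "d = z * cnj w"
    using w mult_cnj_gauss_norm[of w] by (simp add: mult.assoc)
  then show ?thesis
    using w by (auto simp: gauss_dvd_def)
qed

text \<open>Euclidean division: rounding both coordinates leaves a squared distance of at most 1/2,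
  so a remainder is smaller than its divisor.\<close>

lemma gauss_round: "\<exists>q\<in>gauss_ints. cmod (z - q) < 1"
proof
  let ?q = "Complex (of_int (round (Re z))) (of_int (round (Im z)))"
  have r: "\<bar>t - of_int (round t)\<bar> \<le> 1/2" for t :: real
    using of_int_round_abs_le[of t] by (simp add: abs_minus_commute)
  have "(cmod (z - ?q))\<^sup>2 = \<bar>Re z - of_int (round (Re z))\<bar>\<^sup>2 + \<bar>Im z - of_int (round (Im z))\<bar>\<^sup>2"
    by (simp add: cmod_power2)
  also have "\<dots> \<le> (1/2)\<^sup>2 + (1/2)\<^sup>2"
    by (intro add_mono power_mono r) auto
  also have "\<dots> < 1\<^sup>2"
    by (simp add: power2_eq_square)
  finally show "cmod (z - ?q) < 1"
    by (rule power2_less_imp_less) simp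
qed simp

text \<open>Take \<open>d\<close> nonzero of least norm in the ideal \<open>I\<close> generated by
  \<open>z\<close> and \<open>w\<close>. The remainder of any element of \<open>I\<close> modulo
  \<open>d\<close> lies in \<open>I\<close> and is smaller, hence 0.\<close>

lemma gauss_bezout:
  assumes "z \<in> gauss_ints" "w \<in> gauss_ints" "z \<noteq> 0"
  obtains d x y where "d \<in> gauss_ints" "d \<noteq> 0" "gauss_dvd d z" "gauss_dvd d w"
    "x \<in> gauss_ints" "y \<in> gauss_ints" "d = x * z + y * w"
proof -
  define I where "I = {x * z + y * w |x y. x \<in> gauss_ints \<and> y \<in> gauss_ints}"
  have I_G: "e \<in> gauss_ints" if "e \<in> I" for e
    using that assms by (auto simp: I_def)
  have "z = 1 * z + 0 * w" "w = 0 * z + 1 * w"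
    by simp_all
  then have z: "z \<in> I" and w: "w \<in> I"
    unfolding I_def by blast+
  obtain d where d: "d \<in> I" "d \<noteq> 0" and min: "\<And>e. e \<in> I \<Longrightarrow> e \<noteq> 0 \<Longrightarrow> gauss_norm d \<le> gauss_norm e"
    using ex_has_least_nat[of "\<lambda>e. e \<in> I \<and> e \<noteq> 0" z gauss_norm] z assms(3) by blast
  have dvd: "gauss_dvd d e" if e: "e \<in> I" for e
  proof -
    obtain q where q: "q \<in> gauss_ints" "cmod (e / d - q) < 1"
      using gauss_round by blast
    define r where "r = e - d * q"
    obtain x y x' y' where "e = x * z + y * w" "d = x' * z + y' * w"
        "x \<in> gauss_ints" "y \<in> gauss_ints" "x' \<in> gauss_ints" "y' \<in> gauss_ints"
      using e d(1) by (auto simp: I_def)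
    then have "r = (x - x' * q) * z + (y - y' * q) * w" "x - x' * q \<in> gauss_ints" "y - y' * q \<in> gauss_ints"
      using q(1) by (auto simp: r_def algebra_simps)
    then have rI: "r \<in> I"
      unfolding I_def by blast
    have "r = d * (e / d - q)"
      using d(2) by (simp add: r_def field_simps)
    then have "cmod r < cmod d"
      using q(2) d(2) by (simp add: norm_mult)
    then have "gauss_norm r < gauss_norm d"
      using rI d(1) I_G by (simp add: gauss_norm_less_iff)
    then have "r = 0"
      using min[OF rI] by force
    then show ?thesis
      using q(1) by (auto simp: r_def gauss_dvd_def)
  qed
  from d(1) obtain x y where "x \<in> gauss_ints" "y \<in> gauss_ints" "d = x * z + y * w"
    by (auto simp: I_def)
  with that[of d] show ?thesis
    using d dvd z w I_G by blast
qed

lemma gauss_dvd_coprime_cancel: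
  assumes "x * d + y * e = 1" "x \<in> gauss_ints" "y \<in> gauss_ints" "w \<in> gauss_ints"
    and "gauss_dvd e (d * w)"
  shows "gauss_dvd e w"
proof -
  have "w = (x * d + y * e) * w"
    using assms(1) by simp
  then have "w = (d * w) * x + e * (y * w)"
    by (simp add: algebra_simps)
  moreover have "gauss_dvd e ((d * w) * x + e * (y * w))"
    using assms by (intro gauss_dvd_add gauss_dvd_mult[of e "d * w" x] gauss_dvd_triv) auto
  ultimately show ?thesis
    by simp
qed

text \<open>Each norm is a multiple of its element, so an integer Bezout relation between the norms
  is also one between \<open>d\<close> and \<open>e\<close>.\<close>

lemma gauss_dvd_coprime_norm_cancel:
  assumes "coprime (gauss_norm d) (gauss_norm e)" "d \<in> gauss_ints" "e \<in> gauss_ints" "w \<in> gauss_ints"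
    and "gauss_dvd e (d * w)"
  shows "gauss_dvd e w"
proof -
  obtain u v where uv: "u * int (gauss_norm d) + v * int (gauss_norm e) = 1"
    using assms(1) bezout_int[of "int (gauss_norm d)" "int (gauss_norm e)"]
    by (auto simp: coprime_iff_gcd_eq_1)
  have "of_int u * cnj d * d + of_int v * cnj e * e =
      of_int u * of_nat (gauss_norm d) + of_int v * (of_nat (gauss_norm e) :: complex)"
    using assms(2,3) by (simp add: mult_cnj_gauss_norm[symmetric] mult_ac)
  also have "\<dots> = of_int (u * int (gauss_norm d) + v * int (gauss_norm e))"
    by simp
  finally have "(of_int u * cnj d) * d + (of_int v * cnj e) * e = 1"
    using uv by simp
  then show ?thesis
    using assms by (intro gauss_dvd_coprime_cancel[of "of_int u * cnj d" d "of_int v * cnj e" e w]) auto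
qed

text \<open>If \<open>\<pi>\<close> divides neither \<open>z\<close> nor \<open>cnj z\<close>, there
  are units of the forms \<open>x * \<pi> + y * z\<close> and
  \<open>x' * \<pi> + y' * cnj z\<close>. In their product every term is a multiple of
  \<open>\<pi>\<close>, because \<open>z * cnj z\<close> is a multiple of \<open>p\<close>; so
  \<open>\<pi>\<close> would divide a unit.\<close>

lemma prime_norm_gauss_dvd:
  assumes p: "prime p" "\<pi> \<in> gauss_ints" "gauss_norm \<pi> = p" and z: "z \<in> gauss_ints" "p dvd gauss_norm z"
  shows "gauss_dvd \<pi> z \<or> gauss_dvd (cnj \<pi>) z"
proof (rule ccontr)
  assume no: "\<not> ?thesis"
  have \<pi>0: "\<pi> \<noteq> 0"
    using p by auto
  \<comment> \<open>The norm of a common divisor of \<open>\<pi>\<close> and \<open>w\<close> is 1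
    or \<open>p\<close>; the value \<open>p\<close> would make it an associate of
    \<open>\<pi>\<close>, which would then divide \<open>w\<close>.\<close>
  have comb: "\<exists>d x y. x \<in> gauss_ints \<and> y \<in> gauss_ints \<and> d \<in> gauss_ints \<and> d = x * \<pi> + y * w \<and> gauss_norm d = 1"
    if w: "w \<in> gauss_ints" and nd: "\<not> gauss_dvd \<pi> w" for w
  proof -
    obtain d x y where d: "d \<in> gauss_ints" "d \<noteq> 0" "gauss_dvd d \<pi>" "gauss_dvd d w"
      "x \<in> gauss_ints" "y \<in> gauss_ints" "d = x * \<pi> + y * w"
      using gauss_bezout[OF p(2) w \<pi>0] .
    have "gauss_norm d \<noteq> p"
      using gauss_dvd_same_norm[OF d(3,1,2)] d(4) nd p(3) gauss_dvd_trans by auto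
    then have "gauss_norm d = 1"
      using gauss_dvd_norm[OF d(3,1)] p by (metis prime_nat_iff)
    then show ?thesis
      using d by blast
  qed
  obtain d x y where d: "x \<in> gauss_ints" "y \<in> gauss_ints" "d \<in> gauss_ints" "d = x * \<pi> + y * z" "gauss_norm d = 1"
    using comb[OF z(1)] no by blast
  have "\<not> gauss_dvd \<pi> (cnj z)"
    using no gauss_dvd_cnj[of \<pi> "cnj z"] by auto
  then obtain d' x' y' where d': "x' \<in> gauss_ints" "y' \<in> gauss_ints" "d' \<in> gauss_ints"
      "d' = x' * \<pi> + y' * cnj z" "gauss_norm d' = 1"
    using comb[of "cnj z"] z(1) by blast
  obtain m where "gauss_norm z = p * m"
    using z(2) by (auto simp: dvd_def)
  then have "z * cnj z = \<pi> * (cnj \<pi> * of_nat m)"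
    using mult_cnj_gauss_norm[OF z(1)] mult_cnj_gauss_norm[OF p(2)] p(3) by (simp add: mult.assoc[symmetric])
  then have "d * d' = \<pi> * (x * d' + y * z * x' + y * y' * (cnj \<pi> * of_nat m))"
    unfolding d(4) d'(4) by (simp add: algebra_simps)
  moreover have "x * d' + y * z * x' + y * y' * (cnj \<pi> * of_nat m) \<in> gauss_ints"
    using d d' z p by auto
  ultimately have "gauss_dvd \<pi> (d * d')"
    unfolding gauss_dvd_def by blast
  from gauss_dvd_norm[OF this p(2)] show False
    using d d' p by (simp add: gauss_norm_mult)
qed

text \<open>A greatest common divisor \<open>d\<close> of \<open>p\<close> and \<open>z\<close> has
  norm \<open>p ^ i\<close> with \<open>i \<le> 2\<close>. For \<open>i = 2\<close> it is an
  associate of \<open>p\<close>, for \<open>i = 1\<close> it is the wanted element, and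
  \<open>i = 0\<close> is impossible because \<open>d * cnj d\<close> is divisible by
  \<open>p\<close>, as \<open>z * cnj z\<close> is.\<close>

lemma prime_dvd_norm_cases:
  assumes p: "prime p" and z: "z \<in> gauss_ints" "p dvd gauss_norm z"
  shows "gauss_dvd (of_nat p) z \<or> (\<exists>\<pi>\<in>gauss_ints. gauss_norm \<pi> = p)"
proof -
  obtain d x y where d: "d \<in> gauss_ints" "d \<noteq> 0" "gauss_dvd d (of_nat p)" "gauss_dvd d z"
    "x \<in> gauss_ints" "y \<in> gauss_ints" "d = x * of_nat p + y * z"
    using gauss_bezout[of "of_nat p" z] z p by auto
  have "gauss_norm d dvd p ^ 2"
    using gauss_dvd_norm[OF d(3,1)] by simp
  then obtain i where i: "i \<le> 2" "gauss_norm d = p ^ i"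
    using p divides_primepow_nat by blast
  consider "i = 0" | "i = 1" | "i = 2"
    using i(1) by linarith
  then show ?thesis
  proof cases
    case 1
    obtain m where m: "gauss_norm z = p * m"
      using z(2) by (auto simp: dvd_def)
    have "1 = d * cnj d"
      using i 1 mult_cnj_gauss_norm[OF d(1)] by simp
    also have "\<dots> = of_nat p * (x * cnj d + y * z * cnj x) + y * cnj y * (z * cnj z)"
      unfolding d(7) by (simp add: algebra_simps)
    also have "z * cnj z = of_nat p * of_nat m"
      using mult_cnj_gauss_norm[OF z(1)] m by simp
    finally have "1 = of_nat p * (x * cnj d + y * z * cnj x + y * cnj y * of_nat m)"
      by (simp add: algebra_simps)
    moreover have "x * cnj d + y * z * cnj x + y * cnj y * of_nat m \<in> gauss_ints"
      using d z by auto
    ultimately have "gauss_dvd (of_nat p) 1"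
      unfolding gauss_dvd_def by blast
    from gauss_dvd_norm[OF this] show ?thesis
      using p by simp
  next
    case 2
    then show ?thesis using i d by auto
  next
    case 3
    then have "gauss_dvd (of_nat p) d"
      using gauss_dvd_same_norm[OF d(3,1,2)] i by simp
    then show ?thesis
      using d(4) gauss_dvd_trans by blast
  qed
qed

text \<open>A vanishing coordinate would make the norm a perfect square.\<close>

lemma prime_norm_Re_Im_nonzero:
  assumes "\<pi> \<in> gauss_ints" "prime (gauss_norm \<pi>)"
  shows "Re \<pi> \<noteq> 0" "Im \<pi> \<noteq> 0"
proof -
  obtain x y :: int where z: "\<pi> = Complex (of_int x) (of_int y)"
    using assms(1) by (rule gauss_intsE)
  have *: "gauss_norm \<pi> \<noteq> nat \<bar>u\<bar> ^ 2" for u :: int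
    using assms(2) by (auto simp: prime_power_iff)
  have "int (gauss_norm \<pi>) = x\<^sup>2 + y\<^sup>2"
    using gauss_norm_Complex z by simp
  moreover have "int (gauss_norm \<pi>) \<noteq> u\<^sup>2" for u :: int
    using *[of u] by (metis abs_ge_zero nat_int nat_power_eq power2_abs)
  ultimately have "x \<noteq> 0" "y \<noteq> 0"
    by force+
  then show "Re \<pi> \<noteq> 0" "Im \<pi> \<noteq> 0"
    by (simp_all add: z)
qed

text \<open>The integers \<open>\<pi> + cnj \<pi> = 2 * x\<close> and
  \<open>\<pi> * cnj \<pi> = p\<close> are coprime, as \<open>p\<close> is odd and x^2 lies strictly
  between 0 and \<open>p\<close>; this yields a Bezout relation between \<open>\<pi>\<close> and its
  conjugate.\<close>

lemma cnj_coprime_cancel: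
  assumes \<pi>: "\<pi> \<in> gauss_ints" "prime (gauss_norm \<pi>)" "gauss_norm \<pi> \<noteq> 2"
    and w: "w \<in> gauss_ints" "gauss_dvd (cnj \<pi>) (\<pi> * w)"
  shows "gauss_dvd (cnj \<pi>) w"
proof -
  obtain x y :: int where z: "\<pi> = Complex (of_int x) (of_int y)"
    using \<pi>(1) by (rule gauss_intsE)
  define p where "p = int (gauss_norm \<pi>)"
  have p: "p = x\<^sup>2 + y\<^sup>2"
    using gauss_norm_Complex z by (simp add: p_def)
  have pp: "prime p"
    using \<pi>(2) by (simp add: p_def)
  have xy: "x \<noteq> 0" "y \<noteq> 0"
    using prime_norm_Re_Im_nonzero[OF \<pi>(1,2)] by (auto simp: z)
  have "\<not> p dvd x"
  proof
    assume "p dvd x"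
    then have "\<bar>p\<bar> \<le> \<bar>x\<bar>"
      using xy dvd_imp_le_int by blast
    moreover have "\<bar>x\<bar> * 1 \<le> \<bar>x\<bar> * \<bar>x\<bar>"
      using xy by (intro mult_left_mono) auto
    moreover have "y\<^sup>2 > 0" "x\<^sup>2 = \<bar>x\<bar> * \<bar>x\<bar>"
      using xy by (auto simp: power2_eq_square abs_mult_self_eq zero_less_mult_iff linorder_neq_iff)
    ultimately show False
      using p by linarith
  qed
  moreover have "\<not> p dvd 2"
    using pp \<pi>(3) primes_dvd_imp_eq[of p 2] by (auto simp: p_def)
  ultimately have "coprime (2 * x) p"
    using pp prime_imp_coprime[of p "2 * x"] by (simp add: prime_dvd_mult_iff coprime_commute)
  then obtain u v where "u * (2 * x) + v * p = 1"
    using bezout_int[of "2 * x" p] by (auto simp: coprime_iff_gcd_eq_1)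
  then have "of_int (u * (2 * x) + v * p) = (1 :: complex)"
    by simp
  moreover have "\<pi> + cnj \<pi> = of_int (2 * x)" "\<pi> * cnj \<pi> = of_int p"
    using mult_cnj_gauss_norm[OF \<pi>(1)] by (simp_all add: z complex_eq_iff p_def)
  ultimately have "of_int u * (\<pi> + cnj \<pi>) + of_int v * (\<pi> * cnj \<pi>) = 1"
    by simp
  then have "of_int u * \<pi> + (of_int u + of_int v * \<pi>) * cnj \<pi> = 1"
    by (simp add: algebra_simps)
  then show ?thesis
    using \<pi> w
    by (intro gauss_dvd_coprime_cancel[of "of_int u" \<pi> "of_int u + of_int v * \<pi>" "cnj \<pi>" w]) auto
qed

text \<open>Splitting is the existence of an element of norm \<open>p\<close>, so no congruence
  modulo 4 enters; 2 is excluded because \<open>1 + \<i>\<close> is associated to its own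
  conjugate.\<close>

definition split_prime :: "nat \<Rightarrow> bool" where
  "split_prime p \<longleftrightarrow> p \<noteq> 2 \<and> (\<exists>\<pi>\<in>gauss_ints. gauss_norm \<pi> = p)"

definition gauss_prime :: "nat \<Rightarrow> complex" where
  "gauss_prime p = (SOME \<pi>. \<pi> \<in> gauss_ints \<and> gauss_norm \<pi> = p)"

text \<open>For prime \<open>p\<close>, one representative of each class of associated Gaussian
  primes dividing \<open>p\<close>.\<close>

definition primes_above :: "nat \<Rightarrow> complex set" where
  "primes_above p = (if p = 2 then {1 + \<i>}
     else if split_prime p then {gauss_prime p, cnj (gauss_prime p)} else {of_nat p})"

lemma gauss_prime:
  assumes "split_prime p"
  shows "gauss_prime p \<in> gauss_ints" "gauss_norm (gauss_prime p) = p"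
proof -
  have "\<exists>\<pi>. \<pi> \<in> gauss_ints \<and> gauss_norm \<pi> = p"
    using assms unfolding split_prime_def by blast
  from someI_ex[OF this] show "gauss_prime p \<in> gauss_ints" "gauss_norm (gauss_prime p) = p"
    by (simp_all only: gauss_prime_def)
qed

lemma gauss_norm_1_plus_i: "gauss_norm (1 + \<i>) = 2"
  by (simp add: gauss_norm_def cmod_power2)

lemma finite_primes_above [simp]: "finite (primes_above p)"
  by (simp add: primes_above_def)

lemma primes_above_gauss_ints: "d \<in> primes_above p \<Longrightarrow> d \<in> gauss_ints"
  using gauss_prime by (auto simp: primes_above_def split: if_splits)

lemma primes_above_norm: "d \<in> primes_above p \<Longrightarrow> \<exists>j\<in>{1,2}. gauss_norm d = p ^ j"
  using gauss_prime gauss_norm_1_plus_i by (auto simp: primes_above_def split: if_splits)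

lemma primes_above_dvd:
  assumes p: "prime p" and z: "z \<in> gauss_ints" "p dvd gauss_norm z"
  shows "\<exists>d\<in>primes_above p. gauss_dvd d z"
proof -
  consider "p = 2" | "split_prime p" "p \<noteq> 2" | "p \<noteq> 2" "\<not> split_prime p"
    by blast
  then show ?thesis
  proof cases
    case 1
    then have "gauss_dvd (1 + \<i>) z \<or> gauss_dvd (cnj (1 + \<i>)) z"
      using p z gauss_norm_1_plus_i by (intro prime_norm_gauss_dvd) auto
    moreover have "gauss_dvd (1 + \<i>) (cnj (1 + \<i>))"
      unfolding gauss_dvd_def by (rule bexI[of _ "-\<i>"]) (auto simp: algebra_simps)
    ultimately show ?thesis
      using 1 gauss_dvd_trans by (auto simp: primes_above_def)
  next
    case 2
    then show ?thesis
      using prime_norm_gauss_dvd[OF p gauss_prime[OF 2(1)] z] by (auto simp: primes_above_def)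
  next
    case 3
    then show ?thesis
      using prime_dvd_norm_cases[OF p z] by (auto simp: primes_above_def split_prime_def)
  qed
qed

text \<open>The form of coprimality that the sieve uses in place of unique factorization. Above
  different primes the norms are coprime; above the same prime, distinct representatives are a
  conjugate pair of a split prime.\<close>

lemma primes_above_cancel:
  assumes p: "prime p" "prime q" and d: "d \<in> primes_above p" "e \<in> primes_above q" "d \<noteq> e"
    and w: "w \<in> gauss_ints" "gauss_dvd e (d * w)"
  shows "gauss_dvd e w"
proof (cases "p = q")
  case False
  have "coprime (gauss_norm d) (gauss_norm e)"
    using primes_above_norm[OF d(1)] primes_above_norm[OF d(2)] p False
    by (auto simp: primes_coprime)
  then show ?thesis
    using d w primes_above_gauss_ints by (intro gauss_dvd_coprime_norm_cancel[of d e w]) auto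
next
  case True
  then have s: "split_prime p" "p \<noteq> 2"
    using d by (auto simp: primes_above_def split: if_splits)
  define \<pi> where "\<pi> = gauss_prime p"
  have \<pi>: "\<pi> \<in> gauss_ints" "gauss_norm \<pi> = p"
    using gauss_prime[OF s(1)] by (auto simp: \<pi>_def)
  consider "d = \<pi>" "e = cnj \<pi>" | "d = cnj \<pi>" "e = \<pi>"
    using d s True by (auto simp: primes_above_def \<pi>_def)
  then show ?thesis
    using cnj_coprime_cancel[of \<pi> w] cnj_coprime_cancel[of "cnj \<pi>" w] \<pi> p s w
    by cases auto
qed

lemma gauss_prime_neq_cnj:
  assumes "split_prime p" "prime p"
  shows "gauss_prime p \<noteq> cnj (gauss_prime p)"
proof -
  have "Im (gauss_prime p) \<noteq> 0"
    using gauss_prime[OF assms(1)] assms(2) by (intro prime_norm_Re_Im_nonzero) simp_all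
  then show ?thesis
    by (simp add: complex_eq_iff)
qed

lemma primes_above_disjoint:
  assumes "prime p" "prime q" "p \<noteq> q"
  shows "primes_above p \<inter> primes_above q = {}"
proof -
  have "p ^ i \<noteq> q ^ j" if "i \<in> {1,2}" "j \<in> {1,2}" for i j :: nat
    using prime_power_inj'[OF assms(1,2), of i j] assms(3) that by auto
  note ne = this
  show ?thesis
  proof (rule ccontr)
    assume "\<not> ?thesis"
    then obtain d where "d \<in> primes_above p" "d \<in> primes_above q"
      by blast
    from primes_above_norm[OF this(1)] primes_above_norm[OF this(2)] show False
      using ne by force
  qed
qed

section \<open>Hecke sums and their Euler product\<close>

text \<open>The exponent \<open>4 * k\<close> makes the value the same for associates. At 0 the
  value is 0 since \<open>0 powr x = 0\<close>, even for \<open>k = 0\<close> where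
  \<open>0 ^ 0 = 1\<close>, so sums may run over all of \<open>gauss_ints\<close>.\<close>

definition hecke :: "nat \<Rightarrow> real \<Rightarrow> complex \<Rightarrow> complex" where
  "hecke k s z = sgn z ^ (4 * k) * of_real (cmod z powr (- (2 * s)))"

definition hecke_L :: "nat \<Rightarrow> real \<Rightarrow> complex" where
  "hecke_L k s = (\<Sum>\<^sub>\<infinity>z\<in>gauss_ints. hecke k s z)"

lemma hecke_mult: "hecke k s (z * w) = hecke k s z * hecke k s w"
  by (simp add: hecke_def sgn_mult norm_mult powr_mult power_mult_distrib)

lemma hecke_0 [simp]: "hecke k s 0 = 0"
  by (simp add: hecke_def)

lemma norm_hecke: "norm (hecke k s z) = cmod z powr (- (2 * s))"
  by (cases "z = 0") (simp_all add: hecke_def norm_mult norm_power norm_sgn)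

lemma hecke_cnj: "hecke k s (cnj z) = cnj (hecke k s z)"
  by (simp add: hecke_def complex_sgn_def)

lemma gauss_units_norm: "u \<in> {1, -1, \<i>, -\<i>} \<Longrightarrow> cmod u = 1"
  by auto

lemma gauss_units_power4: "u \<in> {1, -1, \<i>, -\<i>} \<Longrightarrow> u ^ 4 = 1"
  by (auto simp: power4_eq_xxxx)

lemma hecke_unit: "u \<in> {1, -1, \<i>, -\<i>} \<Longrightarrow> hecke k s u = 1"
  using gauss_units_norm[of u] gauss_units_power4[of u]
  by (simp add: hecke_def sgn_eq power_mult)

lemma summable_on_int_powr:
  fixes s :: real
  assumes "s > 1"
  shows "(\<lambda>x::int. (1 + \<bar>of_int x\<bar>) powr (- s)) summable_on UNIV"
proof -
  let ?f = "\<lambda>x::int. (1 + \<bar>of_int x\<bar>) powr (- s)"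
  have "summable (\<lambda>n. real (Suc n) powr (- s))"
    using assms by (subst summable_Suc_iff) (simp add: summable_real_powr_iff)
  then have nat: "(\<lambda>n::nat. (1 + real n) powr (- s)) summable_on UNIV"
    by (subst summable_on_UNIV_nonneg_real_iff) (auto simp: add.commute)
  have "?f summable_on (int ` UNIV)" "?f summable_on ((\<lambda>n. - int n) ` UNIV)"
    using nat by (subst summable_on_reindex; simp add: inj_on_def o_def)+
  then have "?f summable_on (int ` UNIV \<union> (\<lambda>n. - int n) ` UNIV)"
    by (rule summable_on_union)
  moreover have "x \<in> int ` UNIV \<union> (\<lambda>n. - int n) ` UNIV" for x
    by (cases x rule: int_cases2) auto
  then have "int ` UNIV \<union> (\<lambda>n. - int n) ` UNIV = UNIV"
    by blast
  ultimately show ?thesis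
    by simp
qed

lemma bij_betw_gauss_ints:
  "bij_betw (\<lambda>(x, y). Complex (of_int x) (of_int y)) UNIV gauss_ints"
  by (auto simp: bij_betw_def inj_on_def image_def elim: gauss_intsE)

text \<open>For (x, y) other than (0, 0), \<open>(1 + \<bar>x\<bar>) * (1 + \<bar>y\<bar>)\<close>
  is at most 4 (x^2 + y^2), so the sum is dominated by a product of two one-dimensional
  sums.\<close>

lemma summable_gauss_powr:
  assumes s: "s > 1"
  shows "(\<lambda>z. cmod z powr (- (2 * s))) summable_on gauss_ints"
proof -
  define g where "g = (\<lambda>x::int. (1 + \<bar>of_int x\<bar>) powr (- s))"
  have g: "g summable_on UNIV"
    unfolding g_def by (rule summable_on_int_powr[OF s])
  have "(\<lambda>(x, y). g x * g y) summable_on UNIV \<times> UNIV"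
  proof (rule summable_on_SigmaI)
    show "((\<lambda>y. case (x, y) of (x, y) \<Rightarrow> g x * g y) has_sum g x * infsum g UNIV) UNIV" for x
      using g by (auto intro!: has_sum_cmult_right)
    show "(\<lambda>x. g x * infsum g UNIV) summable_on UNIV"
      using g by (rule summable_on_cmult_left)
  qed (auto simp: g_def)
  then have "(\<lambda>p. 4 powr s * (case p of (x, y) \<Rightarrow> g x * g y)) summable_on UNIV"
    by (intro summable_on_cmult_right) simp
  then have "(\<lambda>p. cmod (case p of (x, y) \<Rightarrow> Complex (of_int x) (of_int y)) powr (- (2 * s))) summable_on UNIV"
  proof (rule summable_on_comparison_test)
    fix p :: "int \<times> int"
    obtain x y where p: "p = (x, y)" by (cases p)
    define N where "N = (real_of_int x)\<^sup>2 + (real_of_int y)\<^sup>2"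
    show "cmod (case p of (x, y) \<Rightarrow> Complex (of_int x) (of_int y)) powr (- (2 * s))
        \<le> 4 powr s * (case p of (x, y) \<Rightarrow> g x * g y)"
    proof (cases "p = (0, 0)")
      case True
      then show ?thesis by (simp add: g_def complex_norm)
    next
      case False
      have sq: "\<bar>real_of_int u\<bar> \<le> (real_of_int u)\<^sup>2" for u
      proof -
        have "\<bar>u\<bar> * 1 \<le> \<bar>u\<bar> * \<bar>u\<bar>"
          by (cases "u = 0") (simp_all add: mult_left_mono del: abs_mult_self_eq)
        then have "\<bar>u\<bar> \<le> u\<^sup>2"
          by (simp add: power2_eq_square abs_mult_self_eq)
        then show ?thesis
          by (metis of_int_abs of_int_le_iff of_int_power)
      qed
      have "x\<^sup>2 + y\<^sup>2 > 0"
        using False p by (simp add: sum_power2_gt_zero_iff)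
      then have N1: "N \<ge> 1"
        unfolding N_def by (metis int_one_le_iff_zero_less of_int_1 of_int_add of_int_le_iff of_int_power)
      have "2 * (\<bar>real_of_int x\<bar> * \<bar>real_of_int y\<bar>) \<le> N"
        using sum_squares_bound[of "\<bar>real_of_int x\<bar>" "\<bar>real_of_int y\<bar>"] by (simp add: N_def)
      then have "(1 + \<bar>real_of_int x\<bar>) * (1 + \<bar>real_of_int y\<bar>) \<le> 4 * N"
        using sq[of x] sq[of y] N1 by (simp add: algebra_simps N_def)
      then have "(4 * N) powr (- s) \<le> ((1 + \<bar>real_of_int x\<bar>) * (1 + \<bar>real_of_int y\<bar>)) powr (- s)"
        using s by (intro powr_mono2') (auto intro: mult_pos_pos)
      also have "\<dots> = g x * g y"
        by (simp add: g_def powr_mult)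
      finally have "4 powr (- s) * N powr (- s) \<le> g x * g y"
        using N1 by (simp add: powr_mult)
      moreover have "cmod (Complex (of_int x) (of_int y)) powr (- (2 * s)) = N powr (- s)"
        using N1 by (simp add: complex_norm N_def powr_half_sqrt[symmetric] powr_powr)
      moreover have "N powr (- s) = 4 powr s * (4 powr (- s) * N powr (- s))"
        by (simp add: powr_minus)
      moreover have "4 powr s * (4 powr (- s) * N powr (- s)) \<le> 4 powr s * (g x * g y)"
        using calculation(1) by (intro mult_left_mono) auto
      ultimately show ?thesis
        by (simp only: p prod.case)
    qed
  qed auto
  then show ?thesis
    by (subst summable_on_reindex_bij_betw[OF bij_betw_gauss_ints, symmetric])
qed

lemma hecke_abs_summable:
  assumes "s > 1" "A \<subseteq> gauss_ints"
  shows "(\<lambda>z. norm (hecke k s z)) summable_on A"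
  using summable_on_subset[OF summable_gauss_powr[OF assms(1)] assms(2)] by (simp add: norm_hecke)

lemma hecke_summable:
  assumes "s > 1" "A \<subseteq> gauss_ints"
  shows "hecke k s summable_on A"
  using hecke_abs_summable[OF assms] by (rule abs_summable_summable)

section \<open>Sieving and the finite Euler product\<close>

definition sieved :: "complex set \<Rightarrow> complex set" where
  "sieved D = {z \<in> gauss_ints. z \<noteq> 0 \<and> (\<forall>d\<in>D. \<not> gauss_dvd d z)}"

lemma infsum_sieved_empty: "infsum (hecke k s) (sieved {}) = hecke_L k s"
  unfolding hecke_L_def by (rule infsum_cong_neutral) (auto simp: sieved_def)

text \<open>One step of the sieve of Eratosthenes: by \<open>cancel\<close>, the multiples of
  \<open>d\<close> inside \<open>sieved D\<close> are exactly \<open>d\<close> times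
  \<open>sieved D\<close>, and by multiplicativity their sum is \<open>hecke k s d\<close> times the
  whole.\<close>

lemma infsum_sieved_insert:
  assumes s: "s > 1" and d: "d \<in> gauss_ints" "d \<noteq> 0"
    and cancel: "\<And>e w. e \<in> D \<Longrightarrow> w \<in> gauss_ints \<Longrightarrow> gauss_dvd e (d * w) \<Longrightarrow> gauss_dvd e w"
  shows "infsum (hecke k s) (sieved (insert d D)) = (1 - hecke k s d) * infsum (hecke k s) (sieved D)"
proof -
  have G: "sieved E \<subseteq> gauss_ints" for E
    by (auto simp: sieved_def)
  have img: "(\<lambda>z. d * z) ` sieved D = {z \<in> sieved D. gauss_dvd d z}"
  proof (intro equalityI subsetI)
    fix z assume "z \<in> (\<lambda>z. d * z) ` sieved D"
    then obtain w where "w \<in> sieved D" "z = d * w" by blast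
    then show "z \<in> {z \<in> sieved D. gauss_dvd d z}"
      using d cancel[of _ w] by (auto simp: sieved_def gauss_dvd_triv)
  next
    fix z assume z: "z \<in> {z \<in> sieved D. gauss_dvd d z}"
    then obtain w where w: "w \<in> gauss_ints" "z = d * w"
      by (auto simp: gauss_dvd_def)
    have "\<not> gauss_dvd e w" if "e \<in> D" for e
      using z w d that gauss_dvd_mult[of e w d] by (auto simp: sieved_def mult.commute)
    then show "z \<in> (\<lambda>z. d * z) ` sieved D"
      using z w by (auto simp: sieved_def)
  qed
  have "infsum (hecke k s) (sieved D) =
      infsum (hecke k s) (sieved (insert d D) \<union> (\<lambda>z. d * z) ` sieved D)"
    unfolding img by (rule arg_cong[where f = "infsum _"]) (auto simp: sieved_def)
  also have "\<dots> = infsum (hecke k s) (sieved (insert d D)) + infsum (hecke k s) ((\<lambda>z. d * z) ` sieved D)"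
    unfolding img by (rule infsum_Un_disjoint) (use G in \<open>auto intro!: hecke_summable[OF s] simp: sieved_def\<close>)
  also have "infsum (hecke k s) ((\<lambda>z. d * z) ` sieved D) = infsum (\<lambda>z. hecke k s d * hecke k s z) (sieved D)"
    using d by (subst infsum_reindex) (auto simp: inj_on_def o_def hecke_mult)
  also have "\<dots> = hecke k s d * infsum (hecke k s) (sieved D)"
    by (rule infsum_cmult_right) (rule hecke_summable[OF s G])
  finally have "infsum (hecke k s) (sieved (insert d D)) =
      infsum (hecke k s) (sieved D) - hecke k s d * infsum (hecke k s) (sieved D)"
    unfolding eq_diff_eq by (rule sym)
  then show ?thesis
    by (simp only: left_diff_distrib mult_1_left)
qed

lemma infsum_sieved:
  assumes s: "s > 1" and fin: "finite D" and D: "D \<subseteq> gauss_ints - {0}"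
    and cancel: "\<And>d e w. d \<in> D \<Longrightarrow> e \<in> D \<Longrightarrow> d \<noteq> e \<Longrightarrow> w \<in> gauss_ints \<Longrightarrow>
      gauss_dvd e (d * w) \<Longrightarrow> gauss_dvd e w"
  shows "infsum (hecke k s) (sieved D) = (\<Prod>d\<in>D. 1 - hecke k s d) * hecke_L k s"
  using fin D cancel
proof (induction D rule: finite_induct)
  case empty
  then show ?case by (simp add: infsum_sieved_empty)
next
  case (insert d D)
  have "infsum (hecke k s) (sieved (insert d D)) = (1 - hecke k s d) * infsum (hecke k s) (sieved D)"
  proof (rule infsum_sieved_insert[OF s])
    fix e w assume "e \<in> D" "w \<in> gauss_ints" "gauss_dvd e (d * w)"
    moreover from this have "d \<noteq> e"
      using insert.hyps by blast
    ultimately show "gauss_dvd e w"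
      using insert.prems(2)[of d e w] by simp
  qed (use insert.prems(1) in auto)
  also have "infsum (hecke k s) (sieved D) = (\<Prod>d\<in>D. 1 - hecke k s d) * hecke_L k s"
  proof (rule insert.IH)
    fix e e' w assume "e \<in> D" "e' \<in> D" "e \<noteq> e'" "w \<in> gauss_ints" "gauss_dvd e' (e * w)"
    then show "gauss_dvd e' w"
      using insert.prems(2)[of e e' w] by simp
  qed (use insert.prems(1) in auto)
  finally show ?case
    using insert.hyps by (simp add: mult.assoc)
qed

text \<open>The reciprocal of the usual local factor, in absolute value: multiplying by it removes
  the multiples of the primes above \<open>p\<close> from the Hecke sum.\<close>

definition euler_factor :: "nat \<Rightarrow> real \<Rightarrow> nat \<Rightarrow> real" where
  "euler_factor k s p = (\<Prod>d\<in>primes_above p. norm (1 - hecke k s d))"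

text \<open>A finite set \<open>F\<close> carries all but at most 1 of the sum of absolute values,
  and elements of norm beyond its maximum avoid \<open>F\<close>. The threshold may depend on
  \<open>s\<close>.\<close>

lemma hecke_tail_small:
  fixes k :: nat
  assumes s: "s > 1"
  shows "\<exists>X0. \<forall>A\<subseteq>gauss_ints. (\<forall>z\<in>A. gauss_norm z > X0) \<longrightarrow> norm (infsum (hecke k s) A) \<le> 1"
proof -
  let ?g = "\<lambda>z. norm (hecke k s z)"
  have sum: "?g summable_on A" if "A \<subseteq> gauss_ints" for A
    using hecke_abs_summable[OF s that] .
  obtain F where F: "finite F" "F \<subseteq> gauss_ints" "dist (sum ?g F) (infsum ?g gauss_ints) \<le> 1"
    using infsum_finite_approximation[OF sum[OF order_refl], of 1] by auto
  show ?thesis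
  proof (intro exI allI impI)
    fix A assume A: "A \<subseteq> gauss_ints" "\<forall>z\<in>A. gauss_norm z > Max (gauss_norm ` F)"
    have disj: "F \<inter> A = {}"
    proof (rule ccontr)
      assume "F \<inter> A \<noteq> {}"
      then obtain z where z: "z \<in> F" "z \<in> A" by blast
      then have "gauss_norm z \<le> Max (gauss_norm ` F)"
        using F(1) by simp
      then show False
        using A(2) z(2) by force
    qed
    have "norm (infsum (hecke k s) A) \<le> infsum ?g A"
      by (rule norm_infsum_bound) (rule sum[OF A(1)])
    moreover have "sum ?g F + infsum ?g A = infsum ?g (F \<union> A)"
      using F(1) by (subst infsum_Un_disjoint[OF sum[OF F(2)] sum[OF A(1)] disj]) simp
    moreover have "infsum ?g (F \<union> A) \<le> infsum ?g gauss_ints"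
      using F(2) A(1) by (intro infsum_mono_neutral sum) auto
    ultimately show "norm (infsum (hecke k s) A) \<le> 1"
      using F(3) by (simp add: dist_real_def)
  qed
qed

text \<open>After the sieve there remain the four units, contributing 1 each, and elements all of
  whose prime factors lie above primes beyond \<open>X\<close>. The latter have norm beyond
  \<open>X\<close> and contribute at most 1, so the modulus lies between 3 and 5; 2 and 6 are
  convenient weaker bounds.\<close>

lemma hecke_euler_product:
  fixes k :: nat
  assumes s: "s > 1"
  shows "\<forall>\<^sub>F X in sequentially.
    norm (hecke_L k s) * (\<Prod>p | prime p \<and> p \<le> X. euler_factor k s p) \<in> {2..6}"
proof -
  obtain X0 where X0: "\<forall>A\<subseteq>gauss_ints. (\<forall>z\<in>A. gauss_norm z > X0) \<longrightarrow>
     norm (infsum (hecke k s) A) \<le> 1"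
    using hecke_tail_small[where k = k, OF s] ..
  show ?thesis
  proof (rule eventually_sequentiallyI)
    fix X assume X: "X0 \<le> X"
    define P where "P = {p. prime p \<and> p \<le> X}"
    define D where "D = (\<Union>p\<in>P. primes_above p)"
    define U where "U = {1, -1, \<i>, -\<i>}"
    have finP: "finite P"
      unfolding P_def by simp
    have norm_D: "gauss_norm d > 1" if "d \<in> D" for d
    proof -
      obtain p where p: "prime p" "d \<in> primes_above p"
        using \<open>d \<in> D\<close> by (auto simp: D_def P_def)
      from primes_above_norm[OF p(2)] prime_gt_1_nat[OF p(1)] show ?thesis
        using one_less_power[of p 2] by auto
    qed
    have D_G: "d \<in> gauss_ints" if "d \<in> D" for d
      using that unfolding D_def by (blast intro: primes_above_gauss_ints)
    have "infsum (hecke k s) (sieved D) = (\<Prod>d\<in>D. 1 - hecke k s d) * hecke_L k s"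
    proof (rule infsum_sieved[OF s])
      show "finite D" using finP by (auto simp: D_def)
      have "d \<noteq> 0" if "d \<in> D" for d
        using norm_D[OF that] by auto
      then show "D \<subseteq> gauss_ints - {0}"
        using D_G by blast
    next
      fix d e w assume "d \<in> D" "e \<in> D" "d \<noteq> e" "w \<in> gauss_ints" "gauss_dvd e (d * w)"
      then show "gauss_dvd e w"
        unfolding D_def P_def by (blast intro: primes_above_cancel)
    qed
    also have "(\<Prod>d\<in>D. 1 - hecke k s d) = (\<Prod>p\<in>P. \<Prod>d\<in>primes_above p. 1 - hecke k s d)"
      unfolding D_def using finP
      by (intro prod.UNION_disjoint ballI impI primes_above_disjoint finite_primes_above)
        (simp_all add: P_def)
    finally have "norm (infsum (hecke k s) (sieved D)) =
        norm (hecke_L k s) * (\<Prod>p\<in>P. euler_factor k s p)"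
      by (simp only: norm_mult prod_norm euler_factor_def mult.commute)
    moreover have "infsum (hecke k s) (sieved D) = 4 + infsum (hecke k s) (sieved D - U)"
    proof -
      have sub: "U \<subseteq> sieved D"
      proof
        fix u assume u: "u \<in> U"
        then have "gauss_norm u = 1"
          by (auto simp: gauss_norm_def U_def)
        then have "\<not> gauss_dvd d u" if "d \<in> D" for d
          using gauss_dvd_norm[of d u] norm_D[OF that] D_G[OF that] by auto
        then show "u \<in> sieved D"
          using u by (auto simp: sieved_def U_def)
      qed
      have "infsum (hecke k s) (sieved D) = infsum (hecke k s) (U \<union> (sieved D - U))"
        using sub by (simp add: Un_absorb1)
      also have "\<dots> = infsum (hecke k s) U + infsum (hecke k s) (sieved D - U)"
        using sub by (intro infsum_Un_disjoint hecke_summable[OF s]) (auto simp: sieved_def)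
      also have "infsum (hecke k s) U = (\<Sum>u\<in>U. 1)"
        by (simp add: U_def hecke_unit del: sum_constant)
      also have "\<dots> = 4"
        by (simp add: U_def complex_eq_iff)
      finally show ?thesis .
    qed
    moreover have "norm (infsum (hecke k s) (sieved D - U)) \<le> 1"
    proof (rule X0[rule_format])
      fix z assume z: "z \<in> sieved D - U"
      then have zG: "z \<in> gauss_ints" "z \<noteq> 0"
        by (auto simp: sieved_def)
      have "gauss_norm z \<noteq> 1"
        using gauss_norm_eq_1D[OF zG(1)] z by (auto simp: U_def)
      then obtain p where p: "prime p" "p dvd gauss_norm z"
        using prime_factor_nat by blast
      then obtain d where "d \<in> primes_above p" "gauss_dvd d z"
        using primes_above_dvd[OF p(1) zG(1) p(2)] by blast
      then have "p \<notin> P"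
        using z by (auto simp: sieved_def D_def)
      then have "p > X"
        using p(1) by (auto simp: P_def)
      moreover have "p \<le> gauss_norm z"
        using p(2) gauss_norm_pos[OF zG] by (simp add: dvd_imp_le)
      ultimately show "gauss_norm z > X0"
        using X by linarith
    qed (auto simp: sieved_def)
    moreover have "norm (4 + w) \<in> {2..6}" if "norm w \<le> 1" for w :: complex
      using that norm_triangle_ineq[of 4 w] norm_diff_ineq[of 4 w] by simp
    ultimately have "norm (hecke_L k s) * (\<Prod>p\<in>P. euler_factor k s p) \<in> {2..6}"
      by metis
    then show "norm (hecke_L k s) * (\<Prod>p | prime p \<and> p \<le> X. euler_factor k s p) \<in> {2..6}"
      by (simp only: P_def)
  qed
qed

section \<open>Hecke sums near 1\<close>

text \<open>Modulo \<open>2 + \<i>\<close> the unit \<open>\<i>\<close> is congruent to -2, and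
  \<open>x - 2 * y\<close> vanishes modulo 5 exactly when \<open>2 * x + y\<close> does.\<close>

lemma gauss_dvd_2_plus_i:
  assumes "5 dvd 2 * x + y"
  shows "gauss_dvd (2 + \<i>) (Complex (of_int x) (of_int y))"
proof -
  obtain t where "2 * x + y = 5 * t"
    using assms by (auto simp: dvd_def)
  then have "y = 5 * t - 2 * x"
    by simp
  then have "Complex (of_int x) (of_int y) = (2 + \<i>) * Complex (of_int t) (of_int (2 * t - x))"
    by (simp add: complex_eq_iff)
  then show ?thesis
    unfolding gauss_dvd_def using Complex_of_int_gauss_ints by blast
qed

text \<open>A complete residue system for a modulus of norm 5. Short representatives make a shift by
  \<open>r\<close> a perturbation of size at most 1.\<close>

definition residues_2_plus_i :: "complex set" where
  "residues_2_plus_i = {0, 1, -1, \<i>, -\<i>}"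

lemma residues_2_plus_i_cover:
  assumes "z \<in> gauss_ints"
  shows "\<exists>r\<in>residues_2_plus_i. gauss_dvd (2 + \<i>) (z - r)"
proof -
  obtain x y where z: "z = Complex (of_int x) (of_int y)"
    using assms by (rule gauss_intsE)
  have sub: "z - Complex (of_int a) (of_int b) = Complex (of_int (x - a)) (of_int (y - b))" for a b
    by (simp add: z complex_eq_iff)
  have "5 dvd 2 * (x - 0) + (y - 0) \<or> 5 dvd 2 * (x - 0) + (y - 1) \<or> 5 dvd 2 * (x - 1) + (y - 0)
      \<or> 5 dvd 2 * (x - (-1)) + (y - 0) \<or> 5 dvd 2 * (x - 0) + (y - (-1))"
    by presburger
  then obtain a b where ab: "(a, b) \<in> {(0, 0), (0, 1), (1, 0), (-1, 0), (0, -1)}"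
    "5 dvd 2 * (x - a) + (y - b)"
    by blast
  have "gauss_dvd (2 + \<i>) (z - Complex (of_int a) (of_int b))"
    unfolding sub by (rule gauss_dvd_2_plus_i[OF ab(2)])
  moreover have "Complex (of_int a) (of_int b) \<in> residues_2_plus_i"
    using ab(1) by (auto simp: residues_2_plus_i_def complex_eq_iff)
  ultimately show ?thesis
    by blast
qed

lemma residues_2_plus_i_gauss_ints: "r \<in> residues_2_plus_i \<Longrightarrow> r \<in> gauss_ints"
  by (auto simp: residues_2_plus_i_def)

lemma residues_2_plus_i_norm: "r \<in> residues_2_plus_i \<Longrightarrow> cmod r \<le> 1"
  by (auto simp: residues_2_plus_i_def)

text \<open>The difference has absolute value at most 2, hence norm at most 4, while a nonzero
  multiple of \<open>2 + \<i>\<close> has norm at least 5.\<close>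

lemma residues_2_plus_i_unique:
  assumes "r \<in> residues_2_plus_i" "r' \<in> residues_2_plus_i" "gauss_dvd (2 + \<i>) (r - r')"
  shows "r = r'"
proof (rule ccontr)
  assume ne: "r \<noteq> r'"
  have G: "r - r' \<in> gauss_ints"
    using assms residues_2_plus_i_gauss_ints by auto
  have "cmod (r - r') \<le> 2"
    using norm_triangle_ineq4[of r r'] residues_2_plus_i_norm[OF assms(1)]
      residues_2_plus_i_norm[OF assms(2)] by linarith
  then have "(cmod (r - r'))\<^sup>2 \<le> 2\<^sup>2"
    by (intro power_mono) auto
  then have "real (gauss_norm (r - r')) \<le> real 4"
    unfolding of_nat_gauss_norm[OF G] by simp
  then have le: "gauss_norm (r - r') \<le> 4"
    by (simp only: of_nat_le_iff)
  have "gauss_norm (2 + \<i>) = 5"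
    by (simp add: gauss_norm_def cmod_power2)
  moreover have "2 + \<i> \<in> gauss_ints"
    by (simp add: gauss_ints_def)
  ultimately have "5 dvd gauss_norm (r - r')"
    using gauss_dvd_norm[OF assms(3)] by simp
  moreover have "gauss_norm (r - r') > 0"
    using gauss_norm_pos[OF G] ne by simp
  ultimately show False
    using le by (auto dest: dvd_imp_le)
qed

text \<open>The square of \<open>2 + \<i>\<close> is \<open>3 + 4 * \<i>\<close>, and this number is
  idempotent modulo 5. So all its positive powers have imaginary part congruent to 4 modulo 5, in
  particular nonzero.\<close>

lemma sgn_2_plus_i_power:
  assumes "k > 0"
  shows "Im (sgn (2 + \<i>) ^ (4 * k)) \<noteq> 0"
proof -
  have *: "\<exists>a b. (3 + 4 * \<i>) ^ Suc n = Complex (of_int a) (of_int b) \<and> a mod 5 = 3 \<and> b mod 5 = 4" for n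
  proof (induction n)
    case 0
    show ?case
      by (rule exI[of _ 3], rule exI[of _ 4]) (simp add: complex_eq_iff)
  next
    case (Suc n)
    then obtain a b where ab: "(3 + 4 * \<i>) ^ Suc n = Complex (of_int a) (of_int b)"
      "a mod 5 = 3" "b mod 5 = 4"
      by blast
    have "(3 + 4 * \<i>) ^ Suc (Suc n) = (3 + 4 * \<i>) * Complex (of_int a) (of_int b)"
      unfolding ab(1)[symmetric] by simp
    also have "\<dots> = Complex (of_int (3 * a - 4 * b)) (of_int (4 * a + 3 * b))"
      by (simp add: complex_eq_iff)
    finally show ?case
      using ab(2,3) by (intro exI[of _ "3 * a - 4 * b"] exI[of _ "4 * a + 3 * b"] conjI; presburger?)
  qed
  obtain n where n: "2 * k = Suc n"
    using assms by (metis gr0_implies_Suc nat_0_less_mult_iff zero_less_numeral)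
  obtain a b where ab: "(3 + 4 * \<i>) ^ Suc n = Complex (of_int a) (of_int b)" "b mod 5 = 4"
    using *[of n] by blast
  have "(2 + \<i>)\<^sup>2 = 3 + 4 * \<i>"
    by (simp add: power2_eq_square complex_eq_iff)
  then have "(2 + \<i>) ^ (4 * k) = (3 + 4 * \<i>) ^ (2 * k)"
    using power_mult[of "2 + \<i>" 2 "2 * k"] by simp
  then have "Im ((2 + \<i>) ^ (4 * k)) = of_int b"
    using ab(1) n by simp
  moreover have "b \<noteq> 0"
    using ab(2) by auto
  moreover have "sgn (2 + \<i>) ^ (4 * k) = (2 + \<i>) ^ (4 * k) / of_real (cmod (2 + \<i>) ^ (4 * k))"
    by (simp add: sgn_eq power_divide)
  ultimately show ?thesis
    by (simp add: complex_eq_iff)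
qed

section \<open>Comparison of residue classes and boundedness for \<open>k > 0\<close>\<close>

lemma norm_sgn_diff_le:
  fixes v w :: complex
  assumes "v \<noteq> 0" "w \<noteq> 0"
  shows "norm (sgn v - sgn w) \<le> 2 * norm (v - w) / norm w"
proof -
  have "norm w *\<^sub>R (sgn v - sgn w) = (v - w) + (norm w - norm v) *\<^sub>R sgn v"
    using assms by (simp add: sgn_div_norm algebra_simps)
  then have "norm (norm w *\<^sub>R (sgn v - sgn w)) \<le> norm (v - w) + norm ((norm w - norm v) *\<^sub>R sgn v)"
    by (metis norm_triangle_ineq)
  also have "norm ((norm w - norm v) *\<^sub>R sgn v) = \<bar>norm w - norm v\<bar>"
    using assms by (simp add: norm_sgn)
  also have "\<dots> \<le> norm (v - w)"
    using norm_triangle_ineq3[of w v] by (simp add: norm_minus_commute)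
  finally have "norm w * norm (sgn v - sgn w) \<le> 2 * norm (v - w)"
    by simp
  then show ?thesis
    using assms by (simp add: field_simps)
qed

text \<open>Mean value bound; since \<open>s\<close> lies between 1 and 2, the derivative is
  dominated by \<open>4 * m powr (-3)\<close> with no dependence on \<open>s\<close>.\<close>

lemma powr_diff_le:
  fixes a b m s :: real
  assumes "1 < s" "s \<le> 2" "1 \<le> m" "m \<le> a" "m \<le> b"
  shows "\<bar>a powr (- (2 * s)) - b powr (- (2 * s))\<bar> \<le> 4 * m powr (-3) * \<bar>a - b\<bar>"
proof -
  have deriv: "((\<lambda>x. x powr (- (2 * s))) has_field_derivative - (2 * s) * x powr (- (2 * s) - 1)) (at x within {m..})"
    if "x \<in> {m..}" for x
  proof -
    have "x > 0"
      using that assms by simp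
    from has_real_derivative_powr[OF this, of "- (2 * s)"] show ?thesis
      by (rule has_field_derivative_at_within)
  qed
  have bound: "norm (- (2 * s) * x powr (- (2 * s) - 1)) \<le> 4 * m powr (-3)" if x: "x \<in> {m..}" for x
  proof -
    have "x powr (- (2 * s) - 1) \<le> x powr (-3)"
      using x assms by (intro powr_mono) auto
    also have "\<dots> \<le> m powr (-3)"
      using x assms by (intro powr_mono2') auto
    finally have "(2 * s) * x powr (- (2 * s) - 1) \<le> 4 * m powr (-3)"
      using assms by (intro mult_mono) auto
    then show ?thesis
      using assms by (simp add: abs_mult)
  qed
  have "convex {m..}" "a \<in> {m..}" "b \<in> {m..}"
    using assms by auto
  from field_differentiable_bound[OF this(1) deriv bound this(2,3)] show ?thesis
    by simp
qed

text \<open>The shift turns the direction by O(1/|z|) on a term of size at most |z|^(-2), and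
  changes the modulus part by O(|z|^(-3)). The bound is summable over the lattice and free of
  \<open>s\<close>; the extra 1 pays for \<open>z = 0\<close>, where
  \<open>0 powr (-3) = 0\<close>.\<close>

lemma hecke_shift_bound:
  assumes s: "1 < s" "s \<le> 2" and z: "z \<in> gauss_ints" and r: "r \<in> residues_2_plus_i"
  shows "norm (hecke k s ((2 + \<i>) * z + r) - hecke k s ((2 + \<i>) * z))
    \<le> (4 * real k + 4) * cmod z powr (-3) + (if z = 0 then 1 else 0)"
proof (cases "z = 0")
  case True
  have "cmod r powr (- (2 * s)) \<le> 1"
    using r by (auto simp: residues_2_plus_i_def)
  then show ?thesis
    using True by (simp add: norm_hecke)
next
  case False
  define w where "w = (2 + \<i>) * z"
  define v where "v = w + r"
  define m where "m = cmod z"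
  have "real (gauss_norm z) \<ge> 1"
    using gauss_norm_pos[OF z False] by simp
  then have "m\<^sup>2 \<ge> 1\<^sup>2"
    using of_nat_gauss_norm[OF z] by (simp add: m_def)
  then have m: "m \<ge> 1"
    by (rule power2_le_imp_le) (simp add: m_def)
  have "cmod (2 + \<i>) \<ge> 2"
    using complex_Re_le_cmod[of "2 + \<i>"] by simp
  then have w: "cmod w \<ge> 2 * m"
    unfolding w_def norm_mult m_def by (intro mult_right_mono) auto
  have vw: "cmod (v - w) \<le> 1"
    using residues_2_plus_i_norm[OF r] by (simp add: v_def)
  have v: "cmod v \<ge> m"
    using w vw m norm_triangle_ineq3[of v w] by linarith
  have nz: "v \<noteq> 0" "w \<noteq> 0"
    using v w m by auto
  have "norm (sgn v - sgn w) \<le> 2 * norm (v - w) / norm w"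
    by (rule norm_sgn_diff_le[OF nz])
  also have "\<dots> \<le> 2 * 1 / (2 * m)"
    using w vw m by (intro frac_le mult_left_mono) auto
  finally have "norm (sgn v - sgn w) \<le> m powr (-1)"
    using m by (simp add: powr_minus_divide)
  moreover have "norm (sgn v ^ (4 * k) - sgn w ^ (4 * k)) \<le> real (4 * k) * norm (sgn v - sgn w)"
    by (rule norm_power_diff) (simp_all add: norm_sgn)
  moreover have "real (4 * k) * norm (sgn v - sgn w) \<le> real (4 * k) * m powr (-1)"
    using calculation(1) by (intro mult_left_mono) auto
  ultimately have *: "norm (sgn v ^ (4 * k) - sgn w ^ (4 * k)) \<le> 4 * real k * m powr (-1)"
    by simp
  have "cmod v powr (- (2 * s)) \<le> m powr (- (2 * s))"
    using m v s by (intro powr_mono2') auto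
  also have "\<dots> \<le> m powr (-2)"
    using m s by (intro powr_mono) auto
  finally have **: "cmod v powr (- (2 * s)) \<le> m powr (-2)" .
  have "\<bar>cmod v powr (- (2 * s)) - cmod w powr (- (2 * s))\<bar> \<le> 4 * m powr (-3) * \<bar>cmod v - cmod w\<bar>"
    using s m v w by (intro powr_diff_le) auto
  also have "\<dots> \<le> 4 * m powr (-3) * 1"
    using vw norm_triangle_ineq3[of v w] by (intro mult_left_mono) auto
  finally have ***: "\<bar>cmod v powr (- (2 * s)) - cmod w powr (- (2 * s))\<bar> \<le> 4 * m powr (-3)"
    by simp
  have "hecke k s v - hecke k s w = (sgn v ^ (4 * k) - sgn w ^ (4 * k)) * of_real (cmod v powr (- (2 * s)))
      + sgn w ^ (4 * k) * of_real (cmod v powr (- (2 * s)) - cmod w powr (- (2 * s)))"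
    by (simp add: hecke_def algebra_simps)
  then have "norm (hecke k s v - hecke k s w)
      \<le> norm ((sgn v ^ (4 * k) - sgn w ^ (4 * k)) * of_real (cmod v powr (- (2 * s))))
      + norm (sgn w ^ (4 * k) * of_real (cmod v powr (- (2 * s)) - cmod w powr (- (2 * s))))"
    by (metis norm_triangle_ineq)
  also have "\<dots> = norm (sgn v ^ (4 * k) - sgn w ^ (4 * k)) * cmod v powr (- (2 * s))
      + \<bar>cmod v powr (- (2 * s)) - cmod w powr (- (2 * s))\<bar>"
    using nz by (simp only: norm_mult norm_power norm_sgn norm_of_real) simp
  also have "\<dots> \<le> 4 * real k * m powr (-1) * m powr (-2) + 4 * m powr (-3)"
    using * ** *** by (intro add_mono mult_mono) auto
  also have "\<dots> = (4 * real k + 4) * m powr (-3)"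
  proof -
    have "m powr (-1) * m powr (-2) = m powr (-3)"
      by (subst powr_add[symmetric]) simp
    then show ?thesis
      by (simp only: mult.assoc distrib_right)
  qed
  finally show ?thesis
    using False by (simp add: w_def v_def m_def)
qed

lemma hecke_L_residues:
  assumes s: "s > 1"
  shows "hecke_L k s = (\<Sum>r\<in>residues_2_plus_i. \<Sum>\<^sub>\<infinity>z\<in>gauss_ints. hecke k s ((2 + \<i>) * z + r))"
proof -
  let ?\<phi> = "\<lambda>r z. (2 + \<i>) * z + r"
  have \<alpha>: "2 + \<i> \<in> gauss_ints" "2 + \<i> \<noteq> 0"
    by (auto simp: gauss_ints_def complex_eq_iff)
  have sub: "?\<phi> r ` gauss_ints \<subseteq> gauss_ints" if "r \<in> residues_2_plus_i" for r
    using residues_2_plus_i_gauss_ints[OF that] \<alpha> by auto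
  have "(\<Sum>r\<in>residues_2_plus_i. \<Sum>\<^sub>\<infinity>z\<in>gauss_ints. hecke k s (?\<phi> r z)) =
      (\<Sum>r\<in>residues_2_plus_i. infsum (hecke k s) (?\<phi> r ` gauss_ints))"
    using \<alpha> by (intro sum.cong refl, subst infsum_reindex) (auto simp: inj_on_def o_def)
  also have "\<dots> = infsum (hecke k s) (\<Union>r\<in>residues_2_plus_i. ?\<phi> r ` gauss_ints)"
  proof (rule sum_infsum)
    show "finite residues_2_plus_i"
      by (simp add: residues_2_plus_i_def)
    show "hecke k s summable_on ?\<phi> r ` gauss_ints" if "r \<in> residues_2_plus_i" for r
      using hecke_summable[OF s sub[OF that]] .
    show "?\<phi> r ` gauss_ints \<inter> ?\<phi> r' ` gauss_ints = {}"
      if r: "r \<in> residues_2_plus_i" "r' \<in> residues_2_plus_i" "r \<noteq> r'" for r r'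
    proof (rule ccontr)
      assume "\<not> ?thesis"
      then obtain z z' where zz: "z \<in> gauss_ints" "z' \<in> gauss_ints" "?\<phi> r z = ?\<phi> r' z'"
        by blast
      have "r - r' = (2 + \<i>) * (z' - z)"
        using zz(3) by (simp add: algebra_simps)
      then have "gauss_dvd (2 + \<i>) (r - r')"
        using zz(1,2) gauss_dvd_triv[of "z' - z" "2 + \<i>"] by simp
      then show False
        using residues_2_plus_i_unique r by blast
    qed
  qed
  also have "(\<Union>r\<in>residues_2_plus_i. ?\<phi> r ` gauss_ints) = gauss_ints"
  proof (rule antisym)
    show "gauss_ints \<subseteq> (\<Union>r\<in>residues_2_plus_i. ?\<phi> r ` gauss_ints)"
    proof
      fix z assume "z \<in> gauss_ints"
      then obtain r where r: "r \<in> residues_2_plus_i" "gauss_dvd (2 + \<i>) (z - r)"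
        using residues_2_plus_i_cover by blast
      then obtain w where w: "w \<in> gauss_ints" "z - r = (2 + \<i>) * w"
        by (auto simp: gauss_dvd_def)
      then have "z = ?\<phi> r w"
        by (simp add: diff_eq_eq)
      with r(1) w(1) show "z \<in> (\<Union>r\<in>residues_2_plus_i. ?\<phi> r ` gauss_ints)"
        by blast
    qed
  qed (use sub in blast)
  finally show ?thesis
    by (simp add: hecke_L_def)
qed

text \<open>Each of the five classes equals \<open>hecke k s (2 + \<i>) * hecke_L k s\<close> up to
  an error of at most \<open>H\<close>. The resulting factor in front of \<open>hecke_L k s\<close>
  has norm at least \<open>\<bar>Im u\<bar>\<close> whatever \<open>s\<close> is, because
  \<open>5 * hecke k s (2 + \<i>)\<close> is a real multiple of the nonreal number
  \<open>u\<close>.\<close>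

lemma hecke_L_bounded:
  assumes k: "k > 0"
  shows "\<exists>B. \<forall>s. 1 < s \<and> s \<le> 2 \<longrightarrow> norm (hecke_L k s) \<le> B"
proof -
  define h where "h = (\<lambda>z. (4 * real k + 4) * cmod z powr (-3) + (if z = 0 then 1 else 0))"
  define H where "H = infsum h gauss_ints"
  define u where "u = sgn (2 + \<i>) ^ (4 * k)"
  have card: "card residues_2_plus_i = 5"
    by (simp add: residues_2_plus_i_def complex_eq_iff)
  have h_sum: "h summable_on gauss_ints"
  proof -
    have "(\<lambda>z. cmod z powr (-3)) summable_on gauss_ints"
      using summable_gauss_powr[of "3/2"] by simp
    moreover have "(\<lambda>z::complex. if z = 0 then 1 else 0 :: real) summable_on gauss_ints"
      by (rule finite_nonzero_values_imp_summable_on) simp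
    ultimately show ?thesis
      unfolding h_def by (intro summable_on_add summable_on_cmult_right)
  qed
  have norm_u: "norm u = 1"
    by (simp add: u_def norm_power norm_sgn complex_eq_iff)
  have Im_u: "Im u \<noteq> 0"
    unfolding u_def by (rule sgn_2_plus_i_power[OF k])
  have "norm (hecke_L k s) \<le> 5 * H / \<bar>Im u\<bar>" if s: "1 < s" "s \<le> 2" for s
  proof -
    define E where "E = (\<lambda>r z. hecke k s ((2 + \<i>) * z + r) - hecke k s ((2 + \<i>) * z))"
    have E_le: "norm (E r z) \<le> h z" if "r \<in> residues_2_plus_i" "z \<in> gauss_ints" for r z
      using hecke_shift_bound[OF s that(2,1)] by (simp add: E_def h_def)
    have E_abs: "(\<lambda>z. norm (E r z)) summable_on gauss_ints" if "r \<in> residues_2_plus_i" for r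
      using h_sum by (rule summable_on_comparison_test) (use E_le[OF that] in auto)
    have E_bound: "norm (infsum (E r) gauss_ints) \<le> H" if "r \<in> residues_2_plus_i" for r
    proof -
      have "norm (infsum (E r) gauss_ints) \<le> infsum (\<lambda>z. norm (E r z)) gauss_ints"
        by (rule norm_infsum_bound[OF E_abs[OF that]])
      also have "\<dots> \<le> H"
        unfolding H_def by (rule infsum_mono[OF E_abs[OF that] h_sum E_le[OF that]])
      finally show ?thesis .
    qed
    have sum0: "(\<lambda>z. hecke k s (2 + \<i>) * hecke k s z) summable_on gauss_ints"
      by (intro summable_on_cmult_right hecke_summable s) simp
    have "(\<Sum>\<^sub>\<infinity>z\<in>gauss_ints. hecke k s ((2 + \<i>) * z + r)) =
        hecke k s (2 + \<i>) * hecke_L k s + infsum (E r) gauss_ints" if "r \<in> residues_2_plus_i" for r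
    proof -
      have "(\<Sum>\<^sub>\<infinity>z\<in>gauss_ints. hecke k s ((2 + \<i>) * z + r)) =
          (\<Sum>\<^sub>\<infinity>z\<in>gauss_ints. hecke k s (2 + \<i>) * hecke k s z + E r z)"
        by (simp add: E_def hecke_mult)
      also have "\<dots> = (\<Sum>\<^sub>\<infinity>z\<in>gauss_ints. hecke k s (2 + \<i>) * hecke k s z) + infsum (E r) gauss_ints"
        by (rule infsum_add[OF sum0 abs_summable_summable[OF E_abs[OF that]]])
      also have "(\<Sum>\<^sub>\<infinity>z\<in>gauss_ints. hecke k s (2 + \<i>) * hecke k s z) = hecke k s (2 + \<i>) * hecke_L k s"
        unfolding hecke_L_def by (rule infsum_cmult_right) (rule hecke_summable[OF s(1) order_refl])
      finally show ?thesis .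
    qed
    then have "(\<Sum>r\<in>residues_2_plus_i. \<Sum>\<^sub>\<infinity>z\<in>gauss_ints. hecke k s ((2 + \<i>) * z + r)) =
        (\<Sum>r\<in>residues_2_plus_i. hecke k s (2 + \<i>) * hecke_L k s + infsum (E r) gauss_ints)"
      by (rule sum.cong[OF refl])
    also have "\<dots> = 5 * hecke k s (2 + \<i>) * hecke_L k s + (\<Sum>r\<in>residues_2_plus_i. infsum (E r) gauss_ints)"
      by (simp add: sum.distrib card)
    finally have "hecke_L k s = 5 * hecke k s (2 + \<i>) * hecke_L k s
        + (\<Sum>r\<in>residues_2_plus_i. infsum (E r) gauss_ints)"
      unfolding hecke_L_residues[OF s(1), symmetric] .
    then have "hecke_L k s - 5 * hecke k s (2 + \<i>) * hecke_L k s =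
        (\<Sum>r\<in>residues_2_plus_i. infsum (E r) gauss_ints)"
      unfolding diff_eq_eq add.commute[of "\<Sum>r\<in>residues_2_plus_i. infsum (E r) gauss_ints"] .
    then have "(1 - 5 * hecke k s (2 + \<i>)) * hecke_L k s = (\<Sum>r\<in>residues_2_plus_i. infsum (E r) gauss_ints)"
      by (simp only: left_diff_distrib mult_1_left)
    moreover have "norm (\<Sum>r\<in>residues_2_plus_i. infsum (E r) gauss_ints) \<le> of_nat (card residues_2_plus_i) * H"
      by (rule sum_norm_bound) (rule E_bound)
    ultimately have "norm (1 - 5 * hecke k s (2 + \<i>)) * norm (hecke_L k s) \<le> 5 * H"
      by (simp add: card norm_mult[symmetric])
    moreover have "norm (1 - 5 * hecke k s (2 + \<i>)) \<ge> \<bar>Im u\<bar>"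
    proof -
      \<comment> \<open>This is 5^(1 - s); it enters only as a real number, so rotating by
        \<open>cnj u\<close> leaves the imaginary part to \<open>cnj u\<close> alone.\<close>
      define t where "t = 5 * cmod (2 + \<i>) powr (- (2 * s))"
      have "u * cnj u = 1"
        using norm_u by (simp add: complex_norm_square[symmetric])
      then have "cnj u * (1 - 5 * hecke k s (2 + \<i>)) = cnj u - of_real t"
        by (simp add: hecke_def u_def[symmetric] t_def right_diff_distrib mult.left_commute[of "cnj u"] mult.assoc[symmetric])
          (simp add: mult.commute)
      then have "norm (1 - 5 * hecke k s (2 + \<i>)) = norm (cnj u - of_real t)"
        using norm_u by (metis complex_mod_cnj mult_1 norm_mult)
      also have "\<dots> \<ge> \<bar>Im (cnj u - of_real t)\<bar>"
        by (rule abs_Im_le_cmod)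
      finally show ?thesis
        by simp
    qed
    then have "\<bar>Im u\<bar> * norm (hecke_L k s) \<le> norm (1 - 5 * hecke k s (2 + \<i>)) * norm (hecke_L k s)"
      by (rule mult_right_mono) simp
    ultimately have "\<bar>Im u\<bar> * norm (hecke_L k s) \<le> 5 * H"
      by linarith
    then show ?thesis
      using Im_u by (simp add: field_simps)
  qed
  then show ?thesis
    by blast
qed

text \<open>For \<open>k = 0\<close> all terms are nonnegative, so a finite part bounds the sum
  below. At s = 1 the triangle of points with \<open>1 \<le> y \<le> x \<le> n\<close> contributes
  at least \<open>harm n / 2\<close>, since column \<open>x\<close> has \<open>x\<close> terms of
  size at least 1/(2 x^2); continuity of the finite sum carries this to some
  \<open>s > 1\<close>.\<close>

lemma hecke_L_0_unbounded: "\<exists>s. 1 < s \<and> s \<le> 2 \<and> norm (hecke_L 0 s) > B"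
proof -
  have "\<forall>\<^sub>F n in sequentially. harm n > 2 * B"
    using harm_at_top by (simp add: filterlim_at_top_dense)
  then obtain n :: nat where n: "harm n > 2 * B"
    by (auto simp: eventually_sequentially)
  define T where "T = Sigma {1..n} (\<lambda>x. {1..x})"
  define \<psi> where "\<psi> = (\<lambda>(x, y). Complex (of_nat x) (of_nat y))"
  define S where "S = (\<lambda>s. \<Sum>p\<in>T. cmod (\<psi> p) powr (- (2 * s)))"
  have finT: "finite T"
    by (simp add: T_def)
  have S1: "S 1 > B"
  proof -
    have le: "1 / (2 * (real x)\<^sup>2) \<le> cmod (\<psi> (x, y)) powr (- (2 * 1))" if "x \<in> {1..n}" "y \<in> {1..x}" for x y
    proof -
      have pos: "(real x)\<^sup>2 + (real y)\<^sup>2 > 0"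
        using that by (intro add_pos_nonneg) auto
      have "(real y)\<^sup>2 \<le> (real x)\<^sup>2"
        using that by (intro power_mono) auto
      then have "1 / (2 * (real x)\<^sup>2) \<le> 1 / ((real x)\<^sup>2 + (real y)\<^sup>2)"
        using pos by (intro frac_le) auto
      also have "\<dots> = cmod (\<psi> (x, y)) powr (- (2 * 1))"
        using pos by (simp add: \<psi>_def complex_norm powr_minus_divide)
      finally show ?thesis .
    qed
    have "harm n / 2 = (\<Sum>x = 1..n. 1 / (2 * real x))"
      by (simp add: harm_def sum_divide_distrib inverse_eq_divide mult.commute)
    also have "\<dots> = (\<Sum>x = 1..n. \<Sum>y = 1..x. 1 / (2 * (real x)\<^sup>2))"
      by (intro sum.cong) (auto simp: power2_eq_square)
    also have "\<dots> \<le> (\<Sum>x = 1..n. \<Sum>y = 1..x. cmod (\<psi> (x, y)) powr (- (2 * 1)))"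
      by (intro sum_mono le)
    also have "\<dots> = S 1"
      unfolding S_def T_def by (subst sum.Sigma) (auto simp: case_prod_unfold)
    finally show ?thesis
      using n by simp
  qed
  have "(S \<longlongrightarrow> S 1) (at_right 1)"
    unfolding S_def
    by (intro tendsto_sum tendsto_powr tendsto_const tendsto_minus tendsto_mult tendsto_ident_at)
      (auto simp: T_def \<psi>_def complex_eq_iff)
  then have "\<forall>\<^sub>F s in at_right 1. S s > B"
    using S1 by (rule order_tendstoD)
  moreover have "\<forall>\<^sub>F s in at_right 1. s \<in> {1<..<(2::real)}"
    by (rule eventually_at_right_real) simp
  ultimately have "\<forall>\<^sub>F s in at_right 1. S s > B \<and> s \<in> {1<..<(2::real)}"
    by (rule eventually_conj)
  then obtain s where s: "S s > B" "1 < s" "s < 2"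
    by (auto dest!: eventually_happens)
  have "S s = (\<Sum>z\<in>\<psi> ` T. cmod z powr (- (2 * s)))"
    unfolding S_def by (subst sum.reindex) (auto simp: inj_on_def \<psi>_def)
  also have "\<dots> \<le> (\<Sum>\<^sub>\<infinity>z\<in>gauss_ints. cmod z powr (- (2 * s)))"
  proof -
    have "\<psi> ` T \<subseteq> gauss_ints"
      by (auto simp: \<psi>_def gauss_ints_def)
    then have "infsum (\<lambda>z. cmod z powr (- (2 * s))) (\<psi> ` T) \<le> (\<Sum>\<^sub>\<infinity>z\<in>gauss_ints. cmod z powr (- (2 * s)))"
      using finT by (intro infsum_mono_neutral summable_gauss_powr s(2) summable_on_finite) auto
    then show ?thesis
      using finT by simp
  qed
  also have "\<dots> = norm (hecke_L 0 s)"
  proof -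
    have "hecke_L 0 s = of_real (\<Sum>\<^sub>\<infinity>z\<in>gauss_ints. cmod z powr (- (2 * s)))"
      unfolding hecke_L_def hecke_def using summable_gauss_powr[OF s(2)]
      by (intro infsumI) (simp add: has_sum_of_real_iff summable_iff_has_sum_infsum)
    moreover have "(\<Sum>\<^sub>\<infinity>z\<in>gauss_ints. cmod z powr (- (2 * s))) \<ge> 0"
      by (rule infsum_nonneg) simp
    ultimately show ?thesis
      by simp
  qed
  finally show ?thesis
    using s by (intro exI[of _ s]) auto
qed

section \<open>An extremal trigonometric polynomial\<close>

text \<open>The Fourier coefficient of index \<open>k\<close> of (2 + 2 cos t)^M after scaling to
  mean 1; it vanishes for \<open>k > M\<close>.\<close>

definition binom_ratio :: "nat \<Rightarrow> nat \<Rightarrow> real" where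
  "binom_ratio M k = real ((2 * M) choose (M + k)) / real ((2 * M) choose M)"

lemma binom_ratio_nonneg: "binom_ratio M k \<ge> 0"
  by (simp add: binom_ratio_def)

lemma binom_ratio_0: "binom_ratio M 0 = 1"
  by (simp add: binom_ratio_def)

lemma binom_ratio_le_1: "binom_ratio M k \<le> 1"
proof (cases "k \<le> M")
  case True
  then have "(2 * M) choose (M + k) \<le> (2 * M) choose M"
    by (intro binomial_antimono) auto
  then show ?thesis
    by (simp add: binom_ratio_def divide_le_eq_1)
next
  case False
  then show ?thesis
    by (simp add: binom_ratio_def binomial_eq_0)
qed

lemma binom_ratio_Suc:
  assumes "k < M"
  shows "binom_ratio M (Suc k) = binom_ratio M k * ((real M - real k) / (real M + real k + 1))"
proof -
  have "Suc (M + k) * ((2 * M) choose Suc (M + k)) = (2 * M) * ((2 * M - 1) choose (M + k))"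
    using assms Suc_times_binomial[of "M + k" "2 * M - 1"] by simp
  also have "\<dots> = (2 * M - (M + k)) * ((2 * M) choose (M + k))"
    by (rule binomial_absorb_comp[symmetric])
  also have "2 * M - (M + k) = M - k"
    by simp
  finally have "real (Suc (M + k) * ((2 * M) choose Suc (M + k))) = real ((M - k) * ((2 * M) choose (M + k)))"
    by (rule arg_cong)
  then have "(real M + real k + 1) * real ((2 * M) choose Suc (M + k)) = (real M - real k) * real ((2 * M) choose (M + k))"
    using assms by (simp add: of_nat_diff algebra_simps)
  then have "real ((2 * M) choose (M + Suc k)) = real ((2 * M) choose (M + k)) * ((real M - real k) / (real M + real k + 1))"
    by (simp add: field_simps)
  then show ?thesis
    unfolding binom_ratio_def by simp
qed

text \<open>Binomial coefficients decrease away from the centre, so the neighbour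
  \<open>k = 1\<close> gives the maximum.\<close>

lemma binom_ratio_le:
  assumes "1 \<le> k" "k \<le> M"
  shows "binom_ratio M k \<le> real M / (real M + 1)"
proof -
  have "(2 * M) choose (M + k) \<le> (2 * M) choose (M + 1)"
    using assms by (intro binomial_antimono) auto
  then have "binom_ratio M k \<le> binom_ratio M (Suc 0)"
    unfolding binom_ratio_def by (intro divide_right_mono) auto
  also have "\<dots> = real M / (real M + 1)"
    using assms by (subst binom_ratio_Suc) (auto simp: binom_ratio_0)
  finally show ?thesis .
qed

text \<open>For fixed \<open>k\<close> it is a product of \<open>k\<close> quotients, each tending
  to 1.\<close>

lemma binom_ratio_tendsto_1: "(\<lambda>M. binom_ratio M k) \<longlonglongrightarrow> 1"
proof (induction k)
  case 0
  show ?case by (simp add: binom_ratio_0)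
next
  case (Suc k)
  have "(\<lambda>M. (real M - real k) / (real M + real k + 1)) \<longlonglongrightarrow> 1"
    by real_asymp
  from tendsto_mult[OF Suc.IH this]
  have "(\<lambda>M. binom_ratio M k * ((real M - real k) / (real M + real k + 1))) \<longlonglongrightarrow> 1"
    by simp
  then show ?case
    by (rule Lim_transform_eventually)
      (use eventually_gt_at_top[of k] in eventually_elim, simp add: binom_ratio_Suc)
qed

lemma sum_symmetric_interval:
  fixes g :: "nat \<Rightarrow> 'a :: comm_monoid_add"
  assumes "n \<le> M"
  shows "sum g {M - n..M + n} = g M + (\<Sum>k=1..n. g (M - k) + g (M + k))"
  using assms
proof (induction n)
  case (Suc n)
  have "{M - Suc n..M + Suc n} = insert (M - Suc n) (insert (M + Suc n) {M - n..M + n})"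
    using Suc.prems by auto
  then have "sum g {M - Suc n..M + Suc n} = g (M - Suc n) + (g (M + Suc n) + sum g {M - n..M + n})"
    using Suc.prems by (simp only:) (subst sum.insert; auto)+
  then show ?case
    using Suc by (simp add: add_ac)
qed auto

text \<open>On the unit circle 2 + 2 Re w = (w + 1)^2 / w, so the binomial theorem with exponent
  \<open>2 * M\<close> applies, and indices symmetric about \<open>M\<close> combine into real
  parts.\<close>

lemma cos_power_expansion:
  fixes w :: complex
  assumes w: "cmod w = 1"
  shows "(2 + 2 * Re w) ^ M / real ((2 * M) choose M) = 1 + (\<Sum>k=1..M. binom_ratio M k * (2 * Re (w ^ k)))"
proof -
  define g where "g = (\<lambda>j. real ((2 * M) choose j) * Re (w ^ j * cnj w ^ M))"
  have wc: "w * cnj w = 1"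
    using w by (simp add: complex_norm_square[symmetric])
  have split: "w ^ (a + b) * cnj w ^ b = w ^ a" for a b
  proof -
    have "w ^ (a + b) * cnj w ^ b = w ^ a * (w * cnj w) ^ b"
      by (simp add: power_add power_mult_distrib)
    then show ?thesis
      by (simp add: wc)
  qed
  have split': "w ^ b * cnj w ^ (a + b) = cnj w ^ a" for a b
  proof -
    have "w ^ b * cnj w ^ (a + b) = cnj w ^ a * (w * cnj w) ^ b"
      by (simp add: power_add power_mult_distrib)
    then show ?thesis
      by (simp add: wc)
  qed
  have "of_real (2 + 2 * Re w) = (w + 1) * (w + 1) * cnj w"
    using wc by (simp add: algebra_simps complex_eq_iff)
  then have "of_real ((2 + 2 * Re w) ^ M) = ((w + 1) * (w + 1) * cnj w) ^ M"
    by simp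
  also have "\<dots> = (w + 1) ^ (2 * M) * cnj w ^ M"
    by (simp add: power_mult_distrib mult_2 power_add)
  also have "\<dots> = (\<Sum>j\<le>2 * M. of_nat ((2 * M) choose j) * (w ^ j * cnj w ^ M))"
    unfolding binomial_ring by (simp add: sum_distrib_right mult.assoc)
  finally have "Re (of_real ((2 + 2 * Re w) ^ M)) = Re (\<Sum>j\<le>2 * M. of_nat ((2 * M) choose j) * (w ^ j * cnj w ^ M))"
    by (rule arg_cong)
  then have "(2 + 2 * Re w) ^ M = (\<Sum>j\<le>2 * M. g j)"
    by (simp add: g_def)
  also have "{..2 * M} = {M - M..M + M}"
    by auto
  also have "sum g \<dots> = g M + (\<Sum>k=1..M. g (M - k) + g (M + k))"
    by (rule sum_symmetric_interval) simp
  also have "g M = real ((2 * M) choose M)"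
    unfolding g_def using split[of 0 M] by (simp only: add_0 power_0) simp
  also have "(\<Sum>k=1..M. g (M - k) + g (M + k)) = (\<Sum>k=1..M. real ((2 * M) choose (M + k)) * (2 * Re (w ^ k)))"
  proof (rule sum.cong[OF refl])
    fix k assume k: "k \<in> {1..M}"
    have "(2 * M) choose (M - k) = (2 * M) choose (M + k)"
      using k binomial_symmetric[of "M - k" "2 * M"] by simp
    moreover have "w ^ (M - k) * cnj w ^ M = cnj (w ^ k)"
      using k split'[of "M - k" k] by simp
    moreover have "w ^ (M + k) * cnj w ^ M = w ^ k"
      using split[of k M] by (simp add: add.commute)
    ultimately show "g (M - k) + g (M + k) = real ((2 * M) choose (M + k)) * (2 * Re (w ^ k))"
      by (simp only: g_def) (simp del: complex_cnj_power)
  qed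
  finally have "(2 + 2 * Re w) ^ M / real ((2 * M) choose M) =
    (real ((2 * M) choose M) + (\<Sum>k=1..M. real ((2 * M) choose (M + k)) * (2 * Re (w ^ k)))) / real ((2 * M) choose M)"
    by (rule arg_cong)
  then show ?thesis
    by (simp add: add_divide_distrib sum_divide_distrib binom_ratio_def)
qed

text \<open>The central binomial coefficient is at least 4^M / (2 M), so the quotient decays like M
  (1 - delta/2)^M and beats any polynomial factor.\<close>

lemma ex_cos_power_degree:
  fixes \<delta> :: real
  assumes \<delta>: "0 < \<delta>" "\<delta> < 1"
  shows "\<exists>M>0. real (2 * M + 1) * ((4 - 2 * \<delta>) ^ M / real ((2 * M) choose M)) < 1"
proof -
  \<comment> \<open>With the square root, M^2 (1 - delta/2)^M is the square of
    \<open>real M * r ^ M\<close>, which is known to tend to 0.\<close>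
  define r where "r = sqrt (1 - \<delta> / 2)"
  have r: "0 < r" "r < 1" "r\<^sup>2 = 1 - \<delta> / 2"
    using \<delta> by (auto simp: r_def real_sqrt_lt_1_iff)
  have "(\<lambda>n. real n * r ^ n) \<longlonglongrightarrow> 0"
    using r by (intro powser_times_n_limit_0) simp
  from tendsto_power[OF this, of 2] have "(\<lambda>n. 6 * (real n * r ^ n)\<^sup>2) \<longlonglongrightarrow> 0"
    using tendsto_mult_left[of "\<lambda>n. (real n * r ^ n)\<^sup>2" 0 sequentially 6] by simp
  then have "\<forall>\<^sub>F n in sequentially. 6 * (real n * r ^ n)\<^sup>2 < 1"
    by (rule order_tendstoD) simp
  then have "\<forall>\<^sub>F n in sequentially. 6 * (real n * r ^ n)\<^sup>2 < 1 \<and> n > 0"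
    using eventually_gt_at_top[of "0::nat"] by (rule eventually_conj)
  then obtain M where M: "6 * (real M * r ^ M)\<^sup>2 < 1" "M > 0"
    by (auto dest!: eventually_happens)
  have "(4 - 2 * \<delta>) ^ M / real ((2 * M) choose M) \<le> (4 - 2 * \<delta>) ^ M / (4 ^ M / (2 * real M))"
    using \<delta> M(2) by (intro divide_left_mono central_binomial_lower_bound) auto
  also have "\<dots> = 2 * real M * (r\<^sup>2) ^ M"
  proof -
    have "(4 - 2 * \<delta>) ^ M = 4 ^ M * (r\<^sup>2) ^ M"
      by (simp add: r(3) flip: power_mult_distrib)
    then show ?thesis
      by simp
  qed
  finally have "real (2 * M + 1) * ((4 - 2 * \<delta>) ^ M / real ((2 * M) choose M)) \<le> (3 * real M) * (2 * real M * (r\<^sup>2) ^ M)"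
    using M(2) \<delta> by (intro mult_mono) auto
  also have "\<dots> = 6 * (real M * r ^ M)\<^sup>2"
    by (simp add: power2_eq_square power_mult_distrib algebra_simps)
  finally have "real (2 * M + 1) * ((4 - 2 * \<delta>) ^ M / real ((2 * M) choose M)) < 1"
    using M(1) by linarith
  then show ?thesis
    using M(2) by blast
qed

text \<open>
  Let \<open>F\<^sub>M(w) = (2 + 2 Re w)^M / (2M choose M)\<close>. For suitable \<open>A > 1\<close> and \<open>N\<close> much larger than \<open>M\<close>, the
  difference \<open>A F\<^sub>M - F\<^sub>N\<close> has positive mean and nonpositive further Fourier coefficients, but it is at
  most a small constant away from \<open>w = 1\<close>.
\<close>
lemma trig_weights_bound:
  fixes \<delta> :: real
  assumes \<delta>: "0 < \<delta>" "\<delta> < 1"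
  shows "\<exists>N K. \<forall>(Q :: 'a set) a w C. finite Q \<longrightarrow> C \<ge> 0 \<longrightarrow>
    (\<forall>p\<in>Q. a p \<ge> 0 \<and> cmod (w p) = 1 \<and> Re (w p) \<le> 1 - \<delta>) \<longrightarrow>
    (\<forall>k\<in>{1..N}. (\<Sum>p\<in>Q. a p * (2 * Re (w p ^ k))) \<le> C) \<longrightarrow> sum a Q \<le> K * C"
proof -
  obtain M where M: "M > 0" "real (2 * M + 1) * ((4 - 2 * \<delta>) ^ M / real ((2 * M) choose M)) < 1"
    using ex_cos_power_degree[OF \<delta>] by blast
  define \<eta> where "\<eta> = (4 - 2 * \<delta>) ^ M / real ((2 * M) choose M)"
  \<comment> \<open>A value strictly between 1 and (M + 1)/M: above 1 for a positive mean, below (M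
    + 1)/M for the signs of the other coefficients. Since A/(A - 1) = 2 M + 1, the choice of
    \<open>M\<close> is what makes \<open>\<gamma>\<close> positive.\<close>
  define A where "A = real (2 * M + 1) / real (2 * M)"
  \<comment> \<open>The mean \<open>A - 1\<close> of the difference of the two powers, minus its
    upper bound \<open>A * \<eta>\<close> away from 1.\<close>
  define \<gamma> where "\<gamma> = A * (1 - \<eta>) - 1"
  have A: "A > 0"
    using M(1) by (simp add: A_def)
  have \<gamma>: "\<gamma> > 0"
    using M by (simp add: \<gamma>_def A_def \<eta>_def field_simps)
  \<comment> \<open>An upper bound for the coefficients of index 1 to \<open>M\<close> of
    \<open>A\<close> times the smaller power. It is below 1, the limit of the coefficients of the
    larger power as \<open>N\<close> grows.\<close>
  define \<rho> where "\<rho> = A * (real M / (real M + 1))"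
  have \<rho>: "\<rho> < 1"
  proof -
    have "\<rho> = real (2 * M + 1) / real (2 * M + 2)"
      using M(1) by (simp add: \<rho>_def A_def divide_simps)
    then show ?thesis
      by simp
  qed
  have "\<forall>\<^sub>F N in sequentially. \<forall>k\<in>{1..M}. binom_ratio N k > \<rho>"
    using \<rho> by (intro eventually_ball_finite ballI order_tendstoD[OF binom_ratio_tendsto_1]) auto
  then have "\<forall>\<^sub>F N in sequentially. (\<forall>k\<in>{1..M}. binom_ratio N k > \<rho>) \<and> N \<ge> M"
    using eventually_ge_at_top by (rule eventually_conj)
  then obtain N where N: "\<forall>k\<in>{1..M}. binom_ratio N k > \<rho>" "N \<ge> M"
    by (auto dest!: eventually_happens)
  have "sum a Q \<le> real N / \<gamma> * C"
    if Q: "finite (Q :: 'a set)" and C: "C \<ge> 0"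
      and aw: "\<And>p. p \<in> Q \<Longrightarrow> a p \<ge> 0 \<and> cmod (w p) = 1 \<and> Re (w p) \<le> 1 - \<delta>"
      and bound: "\<And>k. k \<in> {1..N} \<Longrightarrow> (\<Sum>p\<in>Q. a p * (2 * Re (w p ^ k))) \<le> C"
    for Q a w C
  proof -
    define S where "S = (\<lambda>k. \<Sum>p\<in>Q. a p * (2 * Re (w p ^ k)))"
    define F where "F = (\<lambda>L p. (2 + 2 * Re (w p)) ^ L / real ((2 * L) choose L))"
    have Re_ge: "2 + 2 * Re (w p) \<ge> 0" if "p \<in> Q" for p
      using aw[OF that] abs_Re_le_cmod[of "w p"] by linarith
    have F_sum: "(\<Sum>p\<in>Q. a p * F L p) = sum a Q + (\<Sum>k=1..L. binom_ratio L k * S k)" for L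
    proof -
      have "(\<Sum>p\<in>Q. a p * F L p) = (\<Sum>p\<in>Q. a p + (\<Sum>k=1..L. binom_ratio L k * (a p * (2 * Re (w p ^ k)))))"
      proof (rule sum.cong[OF refl])
        fix p assume "p \<in> Q"
        then have "cmod (w p) = 1"
          using aw by blast
        from cos_power_expansion[OF this, of L]
        show "a p * F L p = a p + (\<Sum>k=1..L. binom_ratio L k * (a p * (2 * Re (w p ^ k))))"
          unfolding F_def by (simp only: distrib_left mult_1_right sum_distrib_left mult.left_commute)
      qed
      also have "\<dots> = sum a Q + (\<Sum>k=1..L. \<Sum>p\<in>Q. binom_ratio L k * (a p * (2 * Re (w p ^ k))))"
        by (simp only: sum.distrib) (subst sum.swap, rule refl)
      finally show ?thesis
        by (simp add: S_def sum_distrib_left)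
    qed
    have "(\<Sum>p\<in>Q. a p * F M p) \<le> (\<Sum>p\<in>Q. a p * \<eta>)"
      using aw Re_ge unfolding F_def \<eta>_def
      by (intro sum_mono mult_left_mono divide_right_mono power_mono) fastforce+
    then have 1: "sum a Q + (\<Sum>k=1..M. binom_ratio M k * S k) \<le> \<eta> * sum a Q"
      unfolding F_sum sum_distrib_right[symmetric] by (simp only: mult.commute)
    have "(\<Sum>p\<in>Q. a p * F N p) \<ge> 0"
      using aw Re_ge unfolding F_def by (intro sum_nonneg mult_nonneg_nonneg divide_nonneg_nonneg) auto
    then have 2: "sum a Q + (\<Sum>k=1..N. binom_ratio N k * S k) \<ge> 0"
      unfolding F_sum .
    \<comment> \<open>Only an upper bound on \<open>S k\<close> is given, so its sign is unknown;
      replacing \<open>- S k\<close> by the nonnegative \<open>C - S k\<close> allows coefficients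
      to be compared termwise, at a total cost of at most \<open>real N * C\<close>.\<close>
    have T: "C - S k \<ge> 0" if "k \<in> {1..N}" for k
      using bound[OF that] by (simp add: S_def)
    have "A * (1 - \<eta>) * sum a Q \<le> A * (- (\<Sum>k=1..M. binom_ratio M k * S k))"
      unfolding mult.assoc
    proof (rule mult_left_mono)
      show "(1 - \<eta>) * sum a Q \<le> - (\<Sum>k=1..M. binom_ratio M k * S k)"
        using 1 by (simp only: left_diff_distrib mult_1_left)
    qed (use A in simp)
    also have "\<dots> = (\<Sum>k=1..M. A * (binom_ratio M k * (- S k)))"
      by (simp add: sum_distrib_left sum_negf)
    also have "\<dots> \<le> (\<Sum>k=1..M. binom_ratio N k * (C - S k))"
    proof (rule sum_mono)
      fix k assume k: "k \<in> {1..M}"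
      have "A * (binom_ratio M k * (- S k)) = (A * binom_ratio M k) * (- S k)"
        by (simp only: mult.assoc)
      also have "\<dots> \<le> (A * binom_ratio M k) * (C - S k)"
        using A C binom_ratio_nonneg[of M k] by (intro mult_left_mono) auto
      also have "A * binom_ratio M k \<le> \<rho>"
        unfolding \<rho>_def using A k binom_ratio_le[of k M] by (intro mult_left_mono) auto
      then have "(A * binom_ratio M k) * (C - S k) \<le> binom_ratio N k * (C - S k)"
        using N k T by (intro mult_right_mono) force+
      finally show "A * (binom_ratio M k * (- S k)) \<le> binom_ratio N k * (C - S k)" .
    qed
    also have "\<dots> \<le> (\<Sum>k=1..N. binom_ratio N k * (C - S k))"
      using N T binom_ratio_nonneg by (intro sum_mono2 mult_nonneg_nonneg) auto
    also have "\<dots> = (\<Sum>k=1..N. binom_ratio N k * C) - (\<Sum>k=1..N. binom_ratio N k * S k)"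
      by (simp add: right_diff_distrib sum_subtractf)
    also have "(\<Sum>k=1..N. binom_ratio N k * C) \<le> (\<Sum>k=1..N. 1 * C)"
      using C binom_ratio_le_1 by (intro sum_mono mult_right_mono)
    finally have "A * (1 - \<eta>) * sum a Q \<le> real N * C + sum a Q"
      using 2 by simp
    then have "\<gamma> * sum a Q \<le> real N * C"
      by (simp only: \<gamma>_def left_diff_distrib mult_1_left)
    then show ?thesis
      using \<gamma> by (simp add: field_simps)
  qed
  then show ?thesis
    by (intro exI[of _ N] exI[of _ "real N / \<gamma>"]) blast
qed

section \<open>Primes near the real axis\<close>

text \<open>The fourth power cancels the arbitrary unit in the choice of
  \<open>gauss_prime p\<close>; choosing the conjugate instead conjugates the phase and leaves the
  real parts of its powers unchanged.\<close>

definition prime_phase :: "nat \<Rightarrow> complex" where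
  "prime_phase p = sgn (gauss_prime p) ^ 4"

lemma norm_prime_phase:
  assumes "split_prime p" "prime p"
  shows "cmod (prime_phase p) = 1"
proof -
  have "gauss_prime p \<noteq> 0"
    using gauss_prime(2)[OF assms(1)] assms(2) by auto
  then show ?thesis
    by (simp add: prime_phase_def norm_power norm_sgn)
qed

section \<open>Estimates for single Euler factors\<close>

lemma hecke_gauss_prime:
  assumes "split_prime p" "prime p"
  shows "hecke k s (gauss_prime p) = prime_phase p ^ k * of_real (real p powr (- s))"
proof -
  have "(cmod (gauss_prime p))\<^sup>2 = real p"
    using of_nat_gauss_norm[OF gauss_prime(1)[OF assms(1)]] gauss_prime(2)[OF assms(1)] by simp
  then have "cmod (gauss_prime p) = real p powr (1 / 2)"
    using real_sqrt_unique[of "cmod (gauss_prime p)" "real p"] by (simp add: powr_half_sqrt)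
  then have "cmod (gauss_prime p) powr (- (2 * s)) = real p powr (- s)"
    by (simp add: powr_powr)
  then show ?thesis
    by (simp add: hecke_def prime_phase_def power_mult)
qed

lemma euler_factor_split:
  assumes "split_prime p" "prime p"
  shows "euler_factor k s p = (norm (1 - prime_phase p ^ k * of_real (real p powr (- s))))\<^sup>2"
proof -
  define v where "v = hecke k s (gauss_prime p)"
  have "primes_above p = {gauss_prime p, cnj (gauss_prime p)}"
    using assms(1) by (simp add: primes_above_def split_prime_def)
  then have "euler_factor k s p = norm (1 - v) * norm (1 - cnj v)"
    using gauss_prime_neq_cnj[OF assms] by (simp add: euler_factor_def v_def hecke_cnj)
  also have "norm (1 - cnj v) = norm (1 - v)"
    by (metis complex_cnj_diff complex_cnj_one complex_mod_cnj)
  finally show ?thesis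
    by (simp add: v_def hecke_gauss_prime[OF assms] power2_eq_square)
qed

lemma hecke_of_nat: "n > 0 \<Longrightarrow> hecke k s (of_nat n) = of_real (real n powr (- (2 * s)))"
  by (simp add: hecke_def sgn_eq)

lemma euler_factor_inert:
  assumes "\<not> split_prime p" "prime p" "p \<noteq> 2"
  shows "euler_factor k s p = \<bar>1 - real p powr (- (2 * s))\<bar>"
proof -
  have "euler_factor k s p = norm (1 - complex_of_real (real p powr (- (2 * s))))"
    using assms prime_gt_0_nat[OF assms(2)]
    by (simp add: euler_factor_def primes_above_def hecke_of_nat)
  also have "\<dots> = \<bar>1 - real p powr (- (2 * s))\<bar>"
    by (metis norm_of_real of_real_1 of_real_diff real_norm_def)
  finally show ?thesis .
qed

lemma euler_factor_2: "euler_factor k s 2 = norm (1 - hecke k s (1 + \<i>))"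
  by (simp add: euler_factor_def primes_above_def)

lemma norm_hecke_1_plus_i: "norm (hecke k s (1 + \<i>)) = 2 powr (- s)"
proof -
  have "cmod (1 + \<i>) = 2 powr (1 / 2)"
    by (simp add: cmod_def powr_half_sqrt)
  then show ?thesis
    by (simp add: norm_hecke powr_powr)
qed

lemma prime_powr_le:
  fixes p :: nat
  assumes "prime p" "s > 1"
  shows "real p powr (- s) \<le> 1 / real p" "real p powr (- s) \<le> 1 / 2"
proof -
  have p: "real p \<ge> 2"
    using prime_ge_2_nat[OF assms(1)] by simp
  have "real p powr (- s) \<le> real p powr (- 1)"
    using p assms(2) by (intro powr_mono) auto
  also have "\<dots> = 1 / real p"
    using p by (simp add: powr_minus_divide)
  finally show le: "real p powr (- s) \<le> 1 / real p" .
  also have "1 / real p \<le> 1 / 2"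
    using p by (intro divide_left_mono) auto
  finally show "real p powr (- s) \<le> 1 / 2" .
qed

text \<open>A split factor is \<open>1 - 2 * Re v + u\<^sup>2\<close>, and
  \<open>ln x \<le> x - 1\<close> extracts the linear term with an error of at most 1/p^2. Inert
  factors are below 1, so their negated logarithm is nonnegative; at 2 the factor is at most 2 and
  the extra 1 absorbs its logarithm.\<close>

lemma ln_euler_factor_le:
  assumes p: "prime p" and s: "s > 1"
  shows "euler_factor k s p > 0"
    and "(if split_prime p then real p powr (- s) * (2 * Re (prime_phase p ^ k)) else 0)
      \<le> - ln (euler_factor k s p) + 1 / (real p)\<^sup>2 + (if p = 2 then 1 else 0)"
proof -
  define u where "u = real p powr (- s)"
  have p0: "real p > 0"
    using prime_gt_0_nat[OF p] by simp
  have u: "0 < u" "u \<le> 1 / real p" "u \<le> 1 / 2"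
    using prime_powr_le[OF p s] p0 by (simp_all add: u_def)
  have uu: "u\<^sup>2 \<le> 1 / (real p)\<^sup>2"
    using power_mono[OF u(2), of 2] u(1) by (simp add: power_divide)
  have "euler_factor k s p > 0 \<and>
    (if split_prime p then u * (2 * Re (prime_phase p ^ k)) else 0)
      \<le> - ln (euler_factor k s p) + 1 / (real p)\<^sup>2 + (if p = 2 then 1 else 0)"
  proof -
    consider "split_prime p" "p \<noteq> 2" | "\<not> split_prime p" "p \<noteq> 2" | "\<not> split_prime p" "p = 2"
      unfolding split_prime_def by blast
    then show ?thesis
    proof cases
      case 1
      define v where "v = prime_phase p ^ k * of_real u"
      have ef: "euler_factor k s p = (norm (1 - v))\<^sup>2"
        using euler_factor_split[OF 1(1) p] by (simp add: v_def u_def)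
      have nv: "norm v = u"
        using norm_prime_phase[OF 1(1) p] u(1) by (simp add: v_def norm_mult norm_power)
      then have "v \<noteq> 1"
        using u by auto
      then have pos: "euler_factor k s p > 0"
        by (simp add: ef)
      have "(norm v)\<^sup>2 = (Re v)\<^sup>2 + (Im v)\<^sup>2"
        by (rule cmod_power2)
      then have "euler_factor k s p = 1 - 2 * Re v + u\<^sup>2"
        unfolding ef cmod_power2 nv by (simp add: power2_eq_square algebra_simps)
      moreover have "ln (euler_factor k s p) \<le> euler_factor k s p - 1"
        using ln_le_minus_one[OF pos] .
      moreover have "u * (2 * Re (prime_phase p ^ k)) = 2 * Re v"
        by (simp add: v_def)
      ultimately have "u * (2 * Re (prime_phase p ^ k)) \<le> - ln (euler_factor k s p) + 1 / (real p)\<^sup>2"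
        using uu by linarith
      then show ?thesis
        using pos 1 by simp
    next
      case 2
      define u' where "u' = real p powr (- (2 * s))"
      have u': "0 < u'" "u' \<le> 1 / 2"
        using prime_powr_le(2)[OF p, of "2 * s"] s p0 by (simp_all add: u'_def)
      have ef: "euler_factor k s p = 1 - u'"
        using euler_factor_inert[OF 2(1) p 2(2)] u' by (simp add: u'_def)
      have "ln (1 - u') \<le> 0"
        using u' by (subst ln_le_zero_iff) auto
      moreover have "1 / (real p)\<^sup>2 \<ge> 0"
        by simp
      ultimately have "0 \<le> - ln (1 - u') + 1 / (real p)\<^sup>2"
        by linarith
      then show ?thesis
        using 2 u' unfolding ef by simp
    next
      case 3
      have h: "norm (hecke k s (1 + \<i>)) \<le> 1 / 2"
        using u(3) 3 by (simp add: norm_hecke_1_plus_i u_def)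
      have ef: "euler_factor k s p \<ge> 1 / 2" "euler_factor k s p \<le> 2"
        using norm_triangle_ineq4[of 1 "hecke k s (1 + \<i>)"] norm_triangle_ineq2[of 1 "hecke k s (1 + \<i>)"] h 3
        by (simp_all add: euler_factor_2)
      then have "ln (euler_factor k s p) \<le> 2 - 1"
        using ln_le_minus_one[of "euler_factor k s p"] by linarith
      moreover have "1 / (real p)\<^sup>2 \<ge> 0"
        by simp
      ultimately show ?thesis
        using ef 3 by simp
    qed
  qed
  then show "euler_factor k s p > 0"
    "(if split_prime p then real p powr (- s) * (2 * Re (prime_phase p ^ k)) else 0)
      \<le> - ln (euler_factor k s p) + 1 / (real p)\<^sup>2 + (if p = 2 then 1 else 0)"
    unfolding u_def by (rule conjunct1, rule conjunct2)
qed

lemma neg_ln_one_minus_le: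
  fixes u :: real
  assumes "0 \<le> u" "u \<le> 1 / 2"
  shows "- ln (1 - u) \<le> u + 2 * u\<^sup>2"
  using ln_one_minus_pos_lower_bound[OF assms] by linarith

text \<open>The reverse estimate at \<open>k = 0\<close>, where the factors are built from real
  terms \<open>1 - u\<close> and \<open>- ln (1 - u) \<le> u + 2 * u\<^sup>2\<close> applies. The 4
  is twice the 2 of this inequality, from the squared split factor; at 2,
  \<open>u \<le> 1 / 2\<close> gives the extra 1.\<close>

lemma neg_ln_euler_factor_0_le:
  assumes p: "prime p" and s: "s > 1"
  shows "- ln (euler_factor 0 s p)
    \<le> (if split_prime p then 2 * real p powr (- s) else 0) + 4 / (real p)\<^sup>2 + (if p = 2 then 1 else 0)"
proof -
  define u where "u = real p powr (- s)"
  have p0: "real p > 0"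
    using prime_gt_0_nat[OF p] by simp
  have u: "0 < u" "u \<le> 1 / real p" "u \<le> 1 / 2"
    using prime_powr_le[OF p s] p0 by (simp_all add: u_def)
  have uu: "u\<^sup>2 \<le> 1 / (real p)\<^sup>2"
    using power_mono[OF u(2), of 2] u(1) by (simp add: power_divide)
  have 4: "4 / (real p)\<^sup>2 = 4 * (1 / (real p)\<^sup>2)"
    by simp
  have norm_1_minus: "norm (1 - complex_of_real x) = \<bar>1 - x\<bar>" for x
    by (metis norm_of_real of_real_1 of_real_diff real_norm_def)
  consider "split_prime p" "p \<noteq> 2" | "\<not> split_prime p" "p \<noteq> 2" | "\<not> split_prime p" "p = 2"
    unfolding split_prime_def by blast
  then show ?thesis
  proof cases
    case 1
    have ef: "euler_factor 0 s p = (1 - u)\<^sup>2"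
      using euler_factor_split[OF 1(1) p, of 0 s] by (simp add: u_def norm_1_minus)
    have "ln (euler_factor 0 s p) = 2 * ln (1 - u)"
      unfolding ef using u by (subst ln_realpow) auto
    then show ?thesis
      using neg_ln_one_minus_le[of u] u uu 1 4 unfolding u_def[symmetric] by simp
  next
    case 2
    define u' where "u' = real p powr (- (2 * s))"
    have u': "0 < u'" "u' \<le> 1 / 2"
      using prime_powr_le(2)[OF p, of "2 * s"] s p0 by (simp_all add: u'_def)
    have "u' = u\<^sup>2"
      using p0 by (simp add: u_def u'_def power2_eq_square powr_add[symmetric])
    moreover have "u' * u' \<le> u' * (1 / 2)"
      using u' by (intro mult_left_mono) auto
    moreover have ef: "euler_factor 0 s p = 1 - u'"
      using euler_factor_inert[OF 2(1) p 2(2)] u' by (simp add: u'_def)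
    ultimately show ?thesis
      using neg_ln_one_minus_le[of u'] u' uu 2 4 by (simp add: power2_eq_square)
  next
    case 3
    have "hecke 0 s (1 + \<i>) = of_real (norm (hecke 0 s (1 + \<i>)))"
      by (simp add: norm_hecke) (simp add: hecke_def)
    then have "hecke 0 s (1 + \<i>) = of_real u"
      using 3 by (simp add: norm_hecke_1_plus_i u_def)
    then have ef: "euler_factor 0 s p = 1 - u"
      using 3 u by (simp add: euler_factor_2 norm_1_minus)
    have "u\<^sup>2 \<le> (1 / 2)\<^sup>2"
      using u by (intro power_mono) auto
    moreover have "4 / (real p)\<^sup>2 \<ge> 0"
      by simp
    ultimately show ?thesis
      using neg_ln_one_minus_le[of u] u 3 unfolding ef by (simp add: power2_eq_square)
  qed
qed

section \<open>Prime sums and a prime with phase near 1\<close>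

definition split_primes_upto :: "nat \<Rightarrow> nat set" where
  "split_primes_upto X = {p. prime p \<and> p \<le> X \<and> split_prime p}"

lemma finite_split_primes_upto: "finite (split_primes_upto X)"
  by (simp add: split_primes_upto_def)

text \<open>The convergent series that absorbs the second-order terms of all logarithms; its term at
  0 is \<open>1 / 0 = 0\<close>.\<close>

definition sum_inverse_squares :: real where
  "sum_inverse_squares = (\<Sum>n. 1 / (real n)\<^sup>2)"

lemma sum_inverse_squares_ge:
  assumes "finite P"
  shows "(\<Sum>p\<in>P. 1 / (real p)\<^sup>2) \<le> sum_inverse_squares"
  unfolding sum_inverse_squares_def
  using inverse_power_summable[of 2, where 'a = real] assms
  by (intro sum_le_suminf) (auto simp: inverse_eq_divide)

lemma ln_euler_product:
  assumes "s > 1"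
  shows "ln (\<Prod>p | prime p \<and> p \<le> X. euler_factor k s p) = (\<Sum>p | prime p \<and> p \<le> X. ln (euler_factor k s p))"
  by (subst ln_prod) (auto dest!: ln_euler_factor_le(1)[OF _ assms, of _ k])

lemma euler_product_pos:
  assumes "s > 1"
  shows "(\<Prod>p | prime p \<and> p \<le> X. euler_factor k s p) > 0"
  using ln_euler_factor_le(1)[OF _ assms] by (intro prod_pos) auto

lemma sum_split_primes:
  "(\<Sum>p | prime p \<and> p \<le> X. if split_prime p then g p else 0) = sum g (split_primes_upto X)"
  unfolding split_primes_upto_def by (subst sum.inter_filter[symmetric]) (auto intro: sum.cong)

lemma sum_delta_2_le: "(\<Sum>p | prime p \<and> p \<le> X. if p = (2::nat) then 1 else 0 :: real) \<le> 1"
  by (subst sum.delta) auto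

text \<open>From \<open>norm (hecke_L k s) * E \<ge> 2\<close> follows
  \<open>- ln E \<le> ln (norm (hecke_L k s))\<close>. The bound does not involve
  \<open>X\<close>.\<close>

lemma prime_sum_le_ln_L:
  assumes s: "s > 1" and X: "norm (hecke_L k s) * (\<Prod>p | prime p \<and> p \<le> X. euler_factor k s p) \<in> {2..6}"
  shows "(\<Sum>p\<in>split_primes_upto X. real p powr (- s) * (2 * Re (prime_phase p ^ k)))
    \<le> ln (norm (hecke_L k s)) + sum_inverse_squares + 1"
proof -
  let ?P = "{p. prime p \<and> p \<le> X}"
  define E where "E = prod (euler_factor k s) ?P"
  have E: "E > 0"
    unfolding E_def by (rule euler_product_pos[OF s])
  have L: "norm (hecke_L k s) * E \<ge> 2"
    using X by (simp add: E_def)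
  then have L0: "norm (hecke_L k s) > 0"
    by (cases "norm (hecke_L k s) = 0") auto
  have "ln (norm (hecke_L k s) * E) \<ge> 0"
    using L by (intro ln_ge_zero) simp
  then have *: "- ln E \<le> ln (norm (hecke_L k s))"
    using L0 E by (simp add: ln_mult)
  have "(\<Sum>p\<in>split_primes_upto X. real p powr (- s) * (2 * Re (prime_phase p ^ k)))
    = (\<Sum>p\<in>?P. if split_prime p then real p powr (- s) * (2 * Re (prime_phase p ^ k)) else 0)"
    by (rule sum_split_primes[symmetric])
  also have "\<dots> \<le> (\<Sum>p\<in>?P. - ln (euler_factor k s p) + 1 / (real p)\<^sup>2 + (if p = 2 then 1 else 0))"
    using ln_euler_factor_le(2)[OF _ s] by (intro sum_mono) blast
  also have "\<dots> = - ln E + (\<Sum>p\<in>?P. 1 / (real p)\<^sup>2) + (\<Sum>p\<in>?P. if p = 2 then 1 else 0)"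
    unfolding E_def ln_euler_product[OF s] by (simp only: sum.distrib sum_negf)
  also have "\<dots> \<le> ln (norm (hecke_L k s)) + sum_inverse_squares + 1"
    using * by (intro add_mono sum_inverse_squares_ge sum_delta_2_le) auto
  finally show ?thesis .
qed

text \<open>The converse direction, from the upper bound 6: a large Hecke sum at
  \<open>k = 0\<close> forces a large sum of p^(-s) over split primes.\<close>

lemma ln_L_0_le_prime_sum:
  assumes s: "s > 1" and X: "norm (hecke_L 0 s) * (\<Prod>p | prime p \<and> p \<le> X. euler_factor 0 s p) \<in> {2..6}"
  shows "ln (norm (hecke_L 0 s)) \<le> ln 6 + 2 * (\<Sum>p\<in>split_primes_upto X. real p powr (- s))
    + 4 * sum_inverse_squares + 1"
proof -
  let ?P = "{p. prime p \<and> p \<le> X}"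
  define E where "E = prod (euler_factor 0 s) ?P"
  have E: "E > 0"
    unfolding E_def by (rule euler_product_pos[OF s])
  have L: "norm (hecke_L 0 s) * E \<ge> 2" "norm (hecke_L 0 s) * E \<le> 6"
    using X by (simp_all add: E_def)
  then have L0: "norm (hecke_L 0 s) > 0"
    by (cases "norm (hecke_L 0 s) = 0") auto
  have "ln (norm (hecke_L 0 s) * E) \<le> ln 6"
    using L by (subst ln_le_cancel_iff) auto
  then have *: "ln (norm (hecke_L 0 s)) \<le> ln 6 - ln E"
    using L0 E by (simp add: ln_mult)
  have "- ln E = (\<Sum>p\<in>?P. - ln (euler_factor 0 s p))"
    unfolding E_def ln_euler_product[OF s] by (simp only: sum_negf)
  also have "\<dots> \<le> (\<Sum>p\<in>?P. (if split_prime p then 2 * real p powr (- s) else 0) + 4 / (real p)\<^sup>2 + (if p = 2 then 1 else 0))"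
    using neg_ln_euler_factor_0_le[OF _ s] by (intro sum_mono) blast
  also have "\<dots> = (\<Sum>p\<in>?P. if split_prime p then 2 * real p powr (- s) else 0)
      + (\<Sum>p\<in>?P. 4 / (real p)\<^sup>2) + (\<Sum>p\<in>?P. if p = 2 then 1 else 0)"
    by (simp only: sum.distrib)
  also have "(\<Sum>p\<in>?P. if split_prime p then 2 * real p powr (- s) else 0) = 2 * (\<Sum>p\<in>split_primes_upto X. real p powr (- s))"
    unfolding sum_split_primes by (simp only: sum_distrib_left)
  also have "(\<Sum>p\<in>?P. 4 / (real p)\<^sup>2) = 4 * (\<Sum>p\<in>?P. 1 / (real p)\<^sup>2)"
    by (simp add: sum_distrib_left)
  finally have "- ln E \<le> 2 * (\<Sum>p\<in>split_primes_upto X. real p powr (- s))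
      + 4 * (\<Sum>p\<in>?P. 1 / (real p)\<^sup>2) + (\<Sum>p\<in>?P. if p = 2 then 1 else 0)" .
  moreover have "(\<Sum>p\<in>?P. 1 / (real p)\<^sup>2) \<le> sum_inverse_squares"
    by (rule sum_inverse_squares_ge) simp
  moreover note sum_delta_2_le[of X]
  ultimately show ?thesis
    using * by linarith
qed

text \<open>If all phases stayed away from 1, then \<open>trig_weights_bound\<close> with weights
  p^(-s) would bound the sum of these weights independently of \<open>s\<close>, hence also
  \<open>hecke_L 0 s\<close> on (1, 2].\<close>

lemma ex_prime_phase_near_1:
  fixes \<delta> :: real
  assumes \<delta>: "0 < \<delta>" "\<delta> < 1"
  shows "\<exists>p. prime p \<and> split_prime p \<and> Re (prime_phase p) > 1 - \<delta>"
proof (rule ccontr)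
  assume "\<not> ?thesis"
  then have far: "Re (prime_phase p) \<le> 1 - \<delta>" if "prime p" "split_prime p" for p
    using that not_less by blast
  obtain N K where NK: "\<forall>(Q :: nat set) a w C. finite Q \<longrightarrow> C \<ge> 0 \<longrightarrow>
    (\<forall>p\<in>Q. a p \<ge> 0 \<and> cmod (w p) = 1 \<and> Re (w p) \<le> 1 - \<delta>) \<longrightarrow>
    (\<forall>k\<in>{1..N}. (\<Sum>p\<in>Q. a p * (2 * Re (w p ^ k))) \<le> C) \<longrightarrow> sum a Q \<le> K * C"
    using trig_weights_bound[OF \<delta>, where 'a = nat] by (elim exE) 
  have "\<forall>k\<in>{1..N}. \<exists>B. \<forall>s. 1 < s \<and> s \<le> 2 \<longrightarrow> norm (hecke_L k s) \<le> B"
    using hecke_L_bounded by simp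
  then obtain B where B: "\<forall>k\<in>{1..N}. \<forall>s. 1 < s \<and> s \<le> 2 \<longrightarrow> norm (hecke_L k s) \<le> B k"
    by (rule bchoice[THEN exE])
  define Z where "Z = sum_inverse_squares"
  \<comment> \<open>The \<open>max 1\<close> makes every logarithm nonnegative, so their sum
    dominates each one and a single constant, free of \<open>s\<close>, serves all
    \<open>k\<close>.\<close>
  define C where "C = (\<Sum>k=1..N. ln (max 1 (B k))) + Z + 1"
  have Z: "Z \<ge> 0"
    using sum_inverse_squares_ge[of "{}"] by (simp add: Z_def)
  have C: "C \<ge> 0"
    using Z unfolding C_def by (intro add_nonneg_nonneg sum_nonneg) auto
  define D where "D = ln 6 + 2 * (K * C) + 4 * Z + 1"
  have "norm (hecke_L 0 s) \<le> exp D" if s: "1 < s" "s \<le> 2" for s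
  proof -
    have "\<forall>\<^sub>F X in sequentially. \<forall>k\<in>{0..N}. norm (hecke_L k s) * (\<Prod>p | prime p \<and> p \<le> X. euler_factor k s p) \<in> {2..6}"
      using hecke_euler_product[OF s(1)] by (intro eventually_ball_finite) auto
    then obtain X where X: "\<forall>k\<in>{0..N}. norm (hecke_L k s) * (\<Prod>p | prime p \<and> p \<le> X. euler_factor k s p) \<in> {2..6}"
      by (rule eventually_happens[THEN disjE]) (auto simp: trivial_limit_sequentially)
    \<comment> \<open>One \<open>X\<close> works for all \<open>k\<close> up to \<open>N\<close>. It
      depends on \<open>s\<close>, but \<open>C\<close> and \<open>K\<close> do not.\<close>
    define Q where "Q = split_primes_upto X"
    have bound: "(\<Sum>p\<in>Q. real p powr (- s) * (2 * Re (prime_phase p ^ k))) \<le> C" if k: "k \<in> {1..N}" for k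
    proof -
      have XX: "norm (hecke_L k s) * (\<Prod>p | prime p \<and> p \<le> X. euler_factor k s p) \<in> {2..6}"
        using X k by simp
      then have "norm (hecke_L k s) > 0"
        by (cases "norm (hecke_L k s) = 0") auto
      moreover have "norm (hecke_L k s) \<le> max 1 (B k)"
        using B k s by (simp add: le_max_iff_disj)
      ultimately have "ln (norm (hecke_L k s)) \<le> ln (max 1 (B k))"
        by (subst ln_le_cancel_iff) auto
      also have "\<dots> \<le> (\<Sum>k=1..N. ln (max 1 (B k)))"
        using k by (intro member_le_sum) auto
      finally show ?thesis
        using prime_sum_le_ln_L[OF s(1) XX] unfolding Q_def C_def Z_def by linarith
    qed
    have "(\<Sum>p\<in>Q. real p powr (- s)) \<le> K * C"
    proof (rule NK[rule_format])
      show "finite Q"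
        unfolding Q_def by (rule finite_split_primes_upto)
      show "0 \<le> real p powr (- s) \<and> cmod (prime_phase p) = 1 \<and> Re (prime_phase p) \<le> 1 - \<delta>"
        if "p \<in> Q" for p
        using that norm_prime_phase far by (auto simp: Q_def split_primes_upto_def)
    qed (use C bound in auto)
    moreover have "norm (hecke_L 0 s) * (\<Prod>p | prime p \<and> p \<le> X. euler_factor 0 s p) \<in> {2..6}"
      using X by simp
    from ln_L_0_le_prime_sum[OF s(1) this] have "ln (norm (hecke_L 0 s)) \<le> ln 6 + 2 * (\<Sum>p\<in>Q. real p powr (- s)) + 4 * Z + 1"
      by (simp add: Q_def Z_def)
    ultimately have "ln (norm (hecke_L 0 s)) \<le> D"
      unfolding D_def by linarith
    then have "exp (ln (norm (hecke_L 0 s))) \<le> exp D"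
      by (rule exp_le_cancel_iff[THEN iffD2])
    then show ?thesis
      by (cases "hecke_L 0 s = 0") (simp_all del: exp_le_cancel_iff)
  qed
  moreover obtain s where "1 < s" "s \<le> 2" "norm (hecke_L 0 s) > exp D"
    using hecke_L_0_unbounded by blast
  ultimately show False
    by (meson not_less)
qed

section \<open>Lattice points on circles\<close>

text \<open>A phase near 1 means that the direction of the prime is close to a fourth root of unity,
  which is divided out. The remaining angle is nonzero since the prime is not real, and conjugation
  makes it positive.\<close>

lemma ex_gauss_prime_small_angle:
  assumes "\<epsilon> > 0"
  shows "\<exists>p \<pi> \<theta>. prime p \<and> p \<noteq> 2 \<and> \<pi> \<in> gauss_ints \<and> gauss_norm \<pi> = p \<and>
    \<pi> = of_real (sqrt (real p)) * cis \<theta> \<and> 0 < \<theta> \<and> \<theta> < \<epsilon>"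
proof -
  \<comment> \<open>The cap pi/16 keeps \<open>4 * e\<close> at most pi/4, so that
    \<open>1 - cos (4 * e)\<close> lies strictly between 0 and 1.\<close>
  define e where "e = min \<epsilon> (pi / 16)"
  have e: "e > 0" "e \<le> \<epsilon>" "4 * e \<le> pi / 4"
    using assms by (auto simp: e_def)
  have "cos (4 * e) < cos 0"
    using e pi_gt_zero by (intro cos_monotone_0_pi) auto
  moreover have "cos (4 * e) > 0"
    using e pi_gt_zero by (intro cos_gt_zero_pi) linarith+
  ultimately have "0 < 1 - cos (4 * e)" "1 - cos (4 * e) < 1"
    by simp_all
  from ex_prime_phase_near_1[OF this] obtain p where p: "prime p" "split_prime p"
    "Re (prime_phase p) > cos (4 * e)"
    by auto
  define \<pi> where "\<pi> = gauss_prime p"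
  have \<pi>: "\<pi> \<in> gauss_ints" "gauss_norm \<pi> = p"
    using gauss_prime[OF p(2)] by (simp_all add: \<pi>_def)
  have nz: "\<pi> \<noteq> 0"
    using \<pi>(2) p(1) by auto
  define \<phi> where "\<phi> = Arg (prime_phase p)"
  have norm1: "cmod (prime_phase p) = 1"
    by (rule norm_prime_phase[OF p(2,1)])
  then have phase: "prime_phase p = cis \<phi>"
    unfolding \<phi>_def by (subst cis_Arg) (auto simp: sgn_eq)
  have "\<bar>\<phi>\<bar> < 4 * e"
  proof (rule ccontr)
    assume "\<not> \<bar>\<phi>\<bar> < 4 * e"
    moreover have "\<bar>\<phi>\<bar> \<le> pi"
      using Arg_bounded[of "prime_phase p"] by (simp add: \<phi>_def abs_le_iff)
    ultimately have "cos \<bar>\<phi>\<bar> \<le> cos (4 * e)"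
      using e by (intro cos_monotone_0_pi_le) auto
    then show False
      using p(3) phase by simp
  qed
  define \<theta> where "\<theta> = \<phi> / 4"
  have \<theta>: "\<bar>\<theta>\<bar> < \<epsilon>"
    using \<open>\<bar>\<phi>\<bar> < 4 * e\<close> e(2) by (simp add: \<theta>_def)
  define u where "u = sgn \<pi> * cis (- \<theta>)"
  have "u ^ 4 = prime_phase p * cis (- \<phi>)"
    unfolding u_def prime_phase_def \<pi>_def[symmetric] power_mult_distrib Complex.DeMoivre
    by (simp add: \<theta>_def)
  also have "\<dots> = 1"
    unfolding phase by (simp add: cis_mult)
  finally have "(u - 1) * (u + 1) * ((u - \<i>) * (u + \<i>)) = 0"
    by (simp add: algebra_simps power4_eq_xxxx)
  then have u: "u = 1 \<or> u = -1 \<or> u = \<i> \<or> u = -\<i>"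
    by (auto simp: add_eq_0_iff2)
  then have uG: "cnj u \<in> gauss_ints" "u * cnj u = 1"
    by auto
  define \<pi>' where "\<pi>' = \<pi> * cnj u"
  have norm\<pi>: "cmod \<pi> = sqrt (real p)"
    using of_nat_gauss_norm[OF \<pi>(1)] \<pi>(2) by (simp add: real_sqrt_unique)
  have "sgn \<pi> = u * cis \<theta>"
    by (simp add: u_def cis_mult mult.assoc)
  moreover have "\<pi> = of_real (cmod \<pi>) * sgn \<pi>"
    using nz by (simp add: sgn_eq)
  ultimately have "\<pi> = of_real (sqrt (real p)) * (u * cis \<theta>)"
    using norm\<pi> by metis
  then have \<pi>'_eq: "\<pi>' = of_real (sqrt (real p)) * cis \<theta>"
    unfolding \<pi>'_def using uG(2) by (simp add: mult_ac)
  have \<pi>': "\<pi>' \<in> gauss_ints"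
    unfolding \<pi>'_def using \<pi>(1) uG(1) by blast
  have "gauss_norm (cnj u) = 1"
    using u by (auto simp: gauss_norm_def)
  then have norm\<pi>': "gauss_norm \<pi>' = p"
    unfolding \<pi>'_def using \<pi> uG(1) by (simp add: gauss_norm_mult)
  have "Im \<pi>' \<noteq> 0"
    using prime_norm_Re_Im_nonzero(2)[OF \<pi>'] norm\<pi>' p(1) by simp
  then have "\<theta> \<noteq> 0"
    unfolding \<pi>'_eq by auto
  then consider "\<theta> > 0" | "\<theta> < 0"
    by linarith
  then show ?thesis
  proof cases
    case 1
    then show ?thesis
      using p \<pi>' norm\<pi>' \<pi>'_eq \<theta> by (intro exI[of _ p] exI[of _ \<pi>'] exI[of _ \<theta>]) (auto simp: split_prime_def)
  next
    case 2
    have "cnj \<pi>' = of_real (sqrt (real p)) * cis (- \<theta>)"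
      unfolding \<pi>'_eq by (simp add: cis_cnj)
    moreover have "cnj \<pi>' \<in> gauss_ints" "gauss_norm (cnj \<pi>') = p" "p \<noteq> 2" "0 < - \<theta>" "- \<theta> < \<epsilon>"
      using 2 p(2) \<pi>' norm\<pi>' \<theta> by (auto simp: split_prime_def)
    ultimately show ?thesis
      using p(1) by blast
  qed
qed

text \<open>The \<open>k + 1\<close> samples, spaced by \<open>2 * t\<close>, are the midpoints of
  cells filling an interval of half-length \<open>(k + 1) * t\<close> around \<open>c\<close>. On
  each cell the mean value theorem writes the increment of \<open>G\<close> as
  \<open>2 * t * g y\<close> with \<open>y\<close> within \<open>t\<close> of the midpoint.\<close>

lemma midpoint_sum_bound:
  fixes g G :: "real \<Rightarrow> real"
  assumes deriv: "\<And>x. \<bar>x - c\<bar> \<le> real (k + 1) * t \<Longrightarrow> (G has_real_derivative g x) (at x)"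
    and close: "\<And>x y. \<bar>x - c\<bar> \<le> real (k + 1) * t \<Longrightarrow> \<bar>y - c\<bar> \<le> real (k + 1) * t \<Longrightarrow>
      \<bar>x - y\<bar> \<le> t \<Longrightarrow> \<bar>g x - g y\<bar> \<le> \<epsilon>"
    and t: "t > 0"
  shows "\<bar>(\<Sum>j\<le>k. g (c + (2 * real j - real k) * t)) / real (k + 1)
    - (G (c + real (k + 1) * t) - G (c - real (k + 1) * t)) / (2 * (real (k + 1) * t))\<bar> \<le> \<epsilon>"
proof -
  define b where "b = real (k + 1) * t"
  \<comment> \<open>Cell endpoints: the offset is \<open>k + 1\<close>, one more than in the
    samples, so that \<open>x j + t\<close> is the sample of index \<open>j\<close>.\<close>
  define x where "x = (\<lambda>j::nat. c + (2 * real j - real (k + 1)) * t)"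
  have b: "b > 0"
    using t by (simp add: b_def)
  have x_bound: "\<bar>x j - c\<bar> \<le> b" if "j \<le> k + 1" for j
  proof -
    have "\<bar>2 * real j - real (k + 1)\<bar> \<le> real (k + 1)"
      using that by linarith
    then show ?thesis
      using t by (simp add: x_def b_def abs_mult mult_right_mono)
  qed
  have x_Suc: "x (Suc j) = x j + 2 * t" for j
    by (simp add: x_def algebra_simps)
  have cell: "\<bar>G (x (Suc j)) - G (x j) - 2 * t * g (x j + t)\<bar> \<le> 2 * t * \<epsilon>" if j: "j \<le> k" for j
  proof -
    have bd: "\<bar>y - c\<bar> \<le> b" if "x j \<le> y" "y \<le> x (Suc j)" for y
      using x_bound[of j] x_bound[of "Suc j"] j that by linarith
    have "x j < x (Suc j)"
      using t by (simp add: x_Suc)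
    then obtain y where y: "x j < y" "y < x (Suc j)" "G (x (Suc j)) - G (x j) = (x (Suc j) - x j) * g y"
      using MVT2[of "x j" "x (Suc j)" G g] deriv bd unfolding b_def by blast
    have "\<bar>g y - g (x j + t)\<bar> \<le> \<epsilon>"
      using y(1,2) t unfolding x_Suc
      by (intro close bd[unfolded b_def]) (auto simp: x_Suc abs_le_iff)
    then have "2 * t * \<bar>g y - g (x j + t)\<bar> \<le> 2 * t * \<epsilon>"
      using t by (intro mult_left_mono) auto
    moreover have "G (x (Suc j)) - G (x j) - 2 * t * g (x j + t) = 2 * t * (g y - g (x j + t))"
      unfolding y(3) by (simp add: x_Suc right_diff_distrib)
    ultimately show ?thesis
      using t by (simp add: abs_mult)
  qed
  have "(\<Sum>j\<le>k. G (x (Suc j)) - G (x j)) = G (x (Suc k)) - G (x 0)"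
    by (induction k) auto
  also have "x (Suc k) = c + b"
    by (simp add: x_def b_def algebra_simps)
  also have "x 0 = c - b"
    by (simp add: x_def b_def algebra_simps)
  finally have tele: "(\<Sum>j\<le>k. G (x (Suc j)) - G (x j)) = G (c + b) - G (c - b)" .
  define \<Sigma> where "\<Sigma> = (\<Sum>j\<le>k. g (c + (2 * real j - real k) * t))"
  have "\<Sigma> = (\<Sum>j\<le>k. g (x j + t))"
    unfolding \<Sigma>_def x_def by (intro sum.cong refl arg_cong[where f = g]) (simp add: algebra_simps)
  then have "G (c + b) - G (c - b) - 2 * t * \<Sigma> = (\<Sum>j\<le>k. G (x (Suc j)) - G (x j) - 2 * t * g (x j + t))"
    unfolding tele[symmetric] by (simp add: sum_subtractf sum_distrib_left)
  then have "\<bar>G (c + b) - G (c - b) - 2 * t * \<Sigma>\<bar> \<le> (\<Sum>j\<le>k. \<bar>G (x (Suc j)) - G (x j) - 2 * t * g (x j + t)\<bar>)"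
    by (simp only: sum_abs)
  also have "\<dots> \<le> (\<Sum>j\<le>k. 2 * t * \<epsilon>)"
    using cell by (intro sum_mono) auto
  also have "\<dots> = 2 * b * \<epsilon>"
    by (simp add: b_def)
  finally have "\<bar>2 * t * \<Sigma> - (G (c + b) - G (c - b))\<bar> \<le> 2 * b * \<epsilon>"
    by (simp only: abs_minus_commute)
  then have "\<bar>2 * t * \<Sigma> - (G (c + b) - G (c - b))\<bar> / (2 * b) \<le> \<epsilon>"
    using b by (simp add: field_simps)
  also have "\<bar>2 * t * \<Sigma> - (G (c + b) - G (c - b))\<bar> / (2 * b) = \<bar>(2 * t * \<Sigma> - (G (c + b) - G (c - b))) / (2 * b)\<bar>"
    using b by simp
  also have "(2 * t * \<Sigma> - (G (c + b) - G (c - b))) / (2 * b) = \<Sigma> / real (k + 1) - (G (c + b) - G (c - b)) / (2 * b)"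
    using t by (simp add: diff_divide_distrib b_def)
  finally show ?thesis
    by (simp only: \<Sigma>_def b_def)
qed

text \<open>Rounding \<open>a / t i\<close> down gives cells of total half-length
  \<open>(k i + 1) * t i\<close> between \<open>a\<close> and \<open>a + t i\<close>, which tends to
  \<open>a\<close>.\<close>

lemma midpoint_sums_tendsto:
  fixes g :: "real \<Rightarrow> real"
  assumes g: "continuous_on UNIV g" and a: "a > 0"
    and t: "\<And>i. t i > 0" "t \<longlonglongrightarrow> 0"
  defines "k \<equiv> \<lambda>i. nat \<lfloor>a / t i\<rfloor>"
  shows "(\<lambda>i. (\<Sum>j\<le>k i. g (c + (2 * real j - real (k i)) * t i)) / real (k i + 1))
    \<longlonglongrightarrow> integral {c - a..c + a} g / (2 * a)"
proof -
  \<comment> \<open>The margin 1 keeps all cells with \<open>t i < 1\<close> in the open range where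
    \<open>G\<close> is an antiderivative of \<open>g\<close>.\<close>
  define lo hi where "lo = c - a - 1" and "hi = c + a + 1"
  define G where "G = (\<lambda>x. integral {lo..x} g)"
  define b where "b = (\<lambda>i. real (k i + 1) * t i)"
  have g': "continuous_on X g" for X
    using g by (rule continuous_on_subset) simp
  have deriv: "(G has_real_derivative g x) (at x)" if "lo < x" "x < hi" for x
    using integral_has_real_derivative[OF g', of x lo hi] that
    unfolding G_def by (simp add: at_within_Icc_at)
  have b: "a < b i" "b i \<le> a + t i" for i
  proof -
    have k: "real (k i) = of_int \<lfloor>a / t i\<rfloor>"
      using a t(1)[of i] by (simp add: k_def)
    have "a / t i < real (k i) + 1" "real (k i) \<le> a / t i"
      unfolding k by linarith+
    then show "a < b i" "b i \<le> a + t i"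
      using t(1)[of i] by (simp_all add: b_def field_simps)
  qed
  have b_lim: "b \<longlonglongrightarrow> a"
  proof (rule tendsto_sandwich[of "\<lambda>_. a" _ _ "\<lambda>i. a + t i"])
    show "(\<lambda>i. a + t i) \<longlonglongrightarrow> a"
      using tendsto_add[OF tendsto_const t(2), of a] by simp
  qed (auto intro!: always_eventually less_imp_le b)
  define R where "R = (\<lambda>i. (\<Sum>j\<le>k i. g (c + (2 * real j - real (k i)) * t i)) / real (k i + 1))"
  define H where "H = (\<lambda>i. (G (c + b i) - G (c - b i)) / (2 * b i))"
  have "isCont G (c + a)" "isCont G (c - a)"
    using a by (auto intro!: DERIV_isCont deriv simp: lo_def hi_def)
  then have "H \<longlonglongrightarrow> (G (c + a) - G (c - a)) / (2 * a)"
    unfolding H_def using a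
    by (intro tendsto_intros isCont_tendsto_compose[where g = G] b_lim) auto
  moreover have "(\<lambda>i. R i - H i) \<longlonglongrightarrow> 0"
  proof (rule LIMSEQ_I)
    fix r :: real assume r: "r > 0"
    have "uniformly_continuous_on {lo..hi} g"
      by (intro compact_uniformly_continuous g') simp
    then obtain d where d: "d > 0" "\<And>x y. x \<in> {lo..hi} \<Longrightarrow> y \<in> {lo..hi} \<Longrightarrow> dist y x < d \<Longrightarrow> dist (g y) (g x) < r / 2"
      using r unfolding uniformly_continuous_on_def by (meson half_gt_zero)
    have "\<forall>\<^sub>F i in sequentially. t i < min d 1"
      using t(2) d(1) by (intro order_tendstoD) auto
    then obtain n0 where n0: "\<And>i. i \<ge> n0 \<Longrightarrow> t i < min d 1"
      by (auto simp: eventually_sequentially)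
    have "norm (R i - H i - 0) < r" if "i \<ge> n0" for i
    proof -
      have ti: "t i < d" "t i < 1"
        using n0[OF that] by auto
      have inside: "lo < x \<and> x < hi" if "\<bar>x - c\<bar> \<le> real (k i + 1) * t i" for x
        using that b(2)[of i] ti(2) unfolding b_def[symmetric] lo_def hi_def by (auto simp: b_def)
      have "\<bar>R i - H i\<bar> \<le> r / 2"
        unfolding R_def H_def b_def
      proof (rule midpoint_sum_bound)
        show "(G has_real_derivative g x) (at x)" if "\<bar>x - c\<bar> \<le> real (k i + 1) * t i" for x
          using deriv inside[OF that] by blast
        show "\<bar>g x - g y\<bar> \<le> r / 2" if "\<bar>x - c\<bar> \<le> real (k i + 1) * t i" "\<bar>y - c\<bar> \<le> real (k i + 1) * t i"
          "\<bar>x - y\<bar> \<le> t i" for x y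
        proof -
          have "dist (g x) (g y) < r / 2"
            using inside[OF that(1)] inside[OF that(2)] that(3) ti(1) by (intro d(2)) (auto simp: dist_real_def)
          then show ?thesis
            by (simp add: dist_real_def)
        qed
      qed (rule t(1))
      then show ?thesis
        using r by simp
    qed
    then show "\<exists>no. \<forall>n\<ge>no. norm (R n - H n - 0) < r"
      by blast
  qed
  ultimately have "(\<lambda>i. (R i - H i) + H i) \<longlonglongrightarrow> 0 + (G (c + a) - G (c - a)) / (2 * a)"
    by (intro tendsto_add)
  moreover have "G (c + a) - G (c - a) = integral {c - a..c + a} g"
  proof -
    have "integral {lo..c - a} g + integral {c - a..c + a} g = integral {lo..c + a} g"
      using a by (intro Henstock_Kurzweil_Integration.integral_combine integrable_continuous_real g') (auto simp: lo_def)
    then show ?thesis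
      by (simp add: G_def)
  qed
  ultimately show ?thesis
    by (simp add: R_def)
qed

section \<open>The Gaussian integers of norm \<open>p ^ k\<close>\<close>

lemma lattice_points_image:
  "(\<lambda>(x, y). Complex (of_int x) (of_int y)) ` lattice_points n = {z \<in> gauss_ints. gauss_norm z = n}"
proof (intro equalityI subsetI)
  fix z assume "z \<in> (\<lambda>(x, y). Complex (of_int x) (of_int y)) ` lattice_points n"
  then obtain x y where xy: "x\<^sup>2 + y\<^sup>2 = int n" "z = Complex (of_int x) (of_int y)"
    by (auto simp: lattice_points_def)
  then have "int (gauss_norm z) = int n"
    by (simp add: gauss_norm_Complex)
  then show "z \<in> {z \<in> gauss_ints. gauss_norm z = n}"
    using xy by simp
next
  fix z assume "z \<in> {z \<in> gauss_ints. gauss_norm z = n}"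
  then have z: "z \<in> gauss_ints" "gauss_norm z = n" by auto
  obtain x y where xy: "z = Complex (of_int x) (of_int y)"
    using z(1) by (rule gauss_intsE)
  then have "(x, y) \<in> lattice_points n"
    using z(2) gauss_norm_Complex[of x y] by (simp add: lattice_points_def)
  then show "z \<in> (\<lambda>(x, y). Complex (of_int x) (of_int y)) ` lattice_points n"
    using xy by force
qed

lemma inj_Complex_of_int: "inj_on (\<lambda>(x, y). Complex (of_int x) (of_int y)) A"
  by (auto simp: inj_on_def)

lemma gauss_norm_in_sums_of_two_squares:
  assumes "z \<in> gauss_ints" "z \<noteq> 0"
  shows "gauss_norm z \<in> sums_of_two_squares"
proof -
  obtain x y where xy: "z = Complex (of_int x) (of_int y)"
    using assms(1) by (rule gauss_intsE)
  have "int (gauss_norm z) = x\<^sup>2 + y\<^sup>2"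
    unfolding xy by (rule gauss_norm_Complex)
  then show ?thesis
    using gauss_norm_pos[OF assms] by (auto simp: sums_of_two_squares_def)
qed

lemma integral_lattice_measure_gauss:
  fixes f :: "complex \<Rightarrow> real"
  assumes n: "n \<in> sums_of_two_squares" and f: "continuous_on (sphere 0 1) f"
  shows "(\<integral>z. f z \<partial>(lattice_measure n)) =
    (\<Sum>z | z \<in> gauss_ints \<and> gauss_norm z = n. f (z / of_real (sqrt (real n))))
      / real (card {z \<in> gauss_ints. gauss_norm z = n})"
proof -
  have "f \<in> borel_measurable circle_borel"
    unfolding circle_borel_def using f by (rule borel_measurable_continuous_on_restrict)
  note int = integral_lattice_measure[OF n this]
  have card: "card {z \<in> gauss_ints. gauss_norm z = n} = card (lattice_points n)"
    unfolding lattice_points_image[symmetric] by (rule card_image[OF inj_Complex_of_int])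
  have sum: "(\<Sum>z | z \<in> gauss_ints \<and> gauss_norm z = n. f (z / of_real (sqrt (real n)))) =
      (\<Sum>(x, y)\<in>lattice_points n. f (Complex (of_int x) (of_int y) / of_real (sqrt (real n))))"
    unfolding lattice_points_image[symmetric] sum.reindex[OF inj_Complex_of_int]
    by (simp add: case_prod_unfold)
  show ?thesis
    unfolding int card sum by (simp only: real_scaleR_def divide_inverse mult.commute)
qed

text \<open>Induction on \<open>k\<close>: as \<open>p\<close> divides the norm,
  \<open>\<pi>\<close> or its conjugate can be split off, until a unit is left.\<close>

lemma gauss_norm_prime_power:
  assumes \<pi>: "\<pi> \<in> gauss_ints" "gauss_norm \<pi> = p" "prime p"
    and z: "z \<in> gauss_ints" "gauss_norm z = p ^ k"
  shows "\<exists>l<4. \<exists>j\<le>k. z = \<i> ^ l * (\<pi> ^ j * cnj \<pi> ^ (k - j))"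
  using z
proof (induction k arbitrary: z)
  case 0
  then have "z \<in> {1, -1, \<i>, -\<i>}"
    by (intro gauss_norm_eq_1D) auto
  moreover have "\<i> ^ 0 = 1" "\<i> ^ 1 = \<i>" "\<i> ^ 2 = - 1" "\<i> ^ 3 = - \<i>"
    by (simp_all add: power3_eq_cube)
  moreover have "(0::nat) < 4" "(1::nat) < 4" "(2::nat) < 4" "(3::nat) < 4"
    by simp_all
  ultimately have "\<exists>l<4. z = \<i> ^ l"
    by (metis empty_iff insert_iff)
  then show ?case
    by auto
next
  case (Suc k)
  have "p dvd gauss_norm z"
    using Suc.prems by simp
  then consider "gauss_dvd \<pi> z" | "gauss_dvd (cnj \<pi>) z"
    using prime_norm_gauss_dvd[OF \<pi>(3,1,2) Suc.prems(1)] by blast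
  then show ?case
  proof cases
    case 1
    then obtain w where w: "w \<in> gauss_ints" "z = \<pi> * w"
      by (auto simp: gauss_dvd_def)
    then have "gauss_norm w = p ^ k"
      using Suc.prems \<pi> prime_gt_0_nat[OF \<pi>(3)] by (simp add: gauss_norm_mult)
    from Suc.IH[OF w(1) this] obtain l j where "l < 4" "j \<le> k" "w = \<i> ^ l * (\<pi> ^ j * cnj \<pi> ^ (k - j))"
      by blast
    then show ?thesis
      using w(2) by (intro exI[of _ l] exI[of _ "Suc j"] conjI) (auto simp: mult_ac)
  next
    case 2
    then obtain w where w: "w \<in> gauss_ints" "z = cnj \<pi> * w"
      by (auto simp: gauss_dvd_def)
    then have "gauss_norm w = p ^ k"
      using Suc.prems \<pi> prime_gt_0_nat[OF \<pi>(3)] by (simp add: gauss_norm_mult)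
    from Suc.IH[OF w(1) this] obtain l j where "l < 4" "j \<le> k" "w = \<i> ^ l * (\<pi> ^ j * cnj \<pi> ^ (k - j))"
      by blast
    then show ?thesis
      using w(2) by (intro exI[of _ l] exI[of _ j] conjI) (auto simp: mult_ac Suc_diff_le)
  qed
qed

lemma cnj_not_dvd_power:
  assumes \<pi>: "\<pi> \<in> gauss_ints" "prime (gauss_norm \<pi>)" "gauss_norm \<pi> \<noteq> 2"
  shows "\<not> gauss_dvd (cnj \<pi>) (\<pi> ^ m)"
proof (induction m)
  case 0
  show ?case
  proof
    assume "gauss_dvd (cnj \<pi>) (\<pi> ^ 0)"
    from gauss_dvd_norm[OF this] show False
      using \<pi> by simp
  qed
next
  case (Suc m)
  then show ?case
    using cnj_coprime_cancel[OF \<pi>, of "\<pi> ^ m"] \<pi>(1) by auto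
qed

text \<open>If two products agree with \<open>j < j'\<close>, cancelling common factors leaves
  \<open>\<pi> ^ (j' - j)\<close> equal to a unit times \<open>cnj \<pi> ^ (j' - j)\<close>, against
  \<open>cnj_not_dvd_power\<close>. With equal \<open>j\<close> only the powers of
  \<open>\<i>\<close> remain to be compared.\<close>

lemma gauss_prime_power_inj:
  assumes \<pi>: "\<pi> \<in> gauss_ints" "prime (gauss_norm \<pi>)" "gauss_norm \<pi> \<noteq> 2"
  shows "inj_on (\<lambda>(l, j). \<i> ^ l * (\<pi> ^ j * cnj \<pi> ^ (k - j))) ({..<4::nat} \<times> {..k})"
proof -
  have nz: "\<pi> \<noteq> 0"
    using \<pi> by auto
  have le: "j' \<le> j" if eq: "\<i> ^ l * (\<pi> ^ j * cnj \<pi> ^ (k - j)) = \<i> ^ l' * (\<pi> ^ j' * cnj \<pi> ^ (k - j'))"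
    and j: "j \<le> k" "j' \<le> k" and l: "l' < 4" for l l' j j' :: nat
  proof (rule ccontr)
    assume "\<not> j' \<le> j"
    then have lt: "j < j'" by simp
    have "\<pi> ^ j' = \<pi> ^ j * \<pi> ^ (j' - j)" "cnj \<pi> ^ (k - j) = cnj \<pi> ^ (k - j') * cnj \<pi> ^ (j' - j)"
      using lt j by (simp_all flip: power_add)
    then have "(\<pi> ^ j * cnj \<pi> ^ (k - j')) * (\<i> ^ l * cnj \<pi> ^ (j' - j))
        = (\<pi> ^ j * cnj \<pi> ^ (k - j')) * (\<i> ^ l' * \<pi> ^ (j' - j))"
      using eq by (simp add: mult_ac)
    then have "\<i> ^ l * cnj \<pi> ^ (j' - j) = \<i> ^ l' * \<pi> ^ (j' - j)"
      using nz by simp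
    moreover have "\<i> ^ l' * \<i> ^ (4 - l') = 1"
      using l by (simp flip: power_add)
    ultimately have "\<pi> ^ (j' - j) = \<i> ^ (4 - l') * (\<i> ^ l * cnj \<pi> ^ (j' - j))"
      by (metis (no_types, lifting) mult.assoc mult.commute mult_1)
    also have "\<dots> = cnj \<pi> * (\<i> ^ (4 - l') * (\<i> ^ l * cnj \<pi> ^ (j' - j - 1)))"
      using lt by (simp add: power_eq_if[of "cnj \<pi>" "j' - j"])
    finally have "gauss_dvd (cnj \<pi>) (\<pi> ^ (j' - j))"
      unfolding gauss_dvd_def using \<pi>(1) by (auto simp: gauss_ints_power)
    then show False
      using cnj_not_dvd_power[OF \<pi>] by blast
  qed
  show ?thesis
  proof (rule inj_onI, clarify)
    fix l j l' j' :: nat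
    assume l: "l < 4" "l' < 4" and j: "j \<le> k" "j' \<le> k"
      and eq: "\<i> ^ l * (\<pi> ^ j * cnj \<pi> ^ (k - j)) = \<i> ^ l' * (\<pi> ^ j' * cnj \<pi> ^ (k - j'))"
    have "j = j'"
      using le[OF eq j l(2)] le[OF eq[symmetric] j(2,1) l(1)] by simp
    then have "\<i> ^ l = \<i> ^ l'"
      using eq nz by simp
    moreover have "l \<in> {0, 1, 2, 3}" "l' \<in> {0, 1, 2, 3}"
      using l by auto
    ultimately have "l = l'"
      by (auto simp: power3_eq_cube complex_eq_iff)
    with \<open>j = j'\<close> show "l = l' \<and> j = j'"
      by simp
  qed
qed

lemma gauss_prime_power_points:
  assumes \<pi>: "\<pi> \<in> gauss_ints" "gauss_norm \<pi> = p" "prime p" "p \<noteq> 2"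
  shows "bij_betw (\<lambda>(l, j). \<i> ^ l * (\<pi> ^ j * cnj \<pi> ^ (k - j))) ({..<4::nat} \<times> {..k})
    {z \<in> gauss_ints. gauss_norm z = p ^ k}"
proof (rule bij_betw_imageI)
  show "inj_on (\<lambda>(l, j). \<i> ^ l * (\<pi> ^ j * cnj \<pi> ^ (k - j))) ({..<4::nat} \<times> {..k})"
    using \<pi> by (intro gauss_prime_power_inj) auto
  have "gauss_norm \<i> = 1"
    by (simp add: gauss_norm_def)
  then have "gauss_norm (\<i> ^ l * (\<pi> ^ j * cnj \<pi> ^ (k - j))) = p ^ k" if "j \<le> k" for l j
    using \<pi> that by (simp add: gauss_norm_mult gauss_norm_power flip: power_add)
  then show "(\<lambda>(l, j). \<i> ^ l * (\<pi> ^ j * cnj \<pi> ^ (k - j))) ` ({..<4::nat} \<times> {..k})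
      = {z \<in> gauss_ints. gauss_norm z = p ^ k}"
    using gauss_norm_prime_power[OF \<pi>(1-3)] \<pi>(1) by (force simp: image_iff)
qed

lemma integral_lattice_measure_prime_power:
  fixes f :: "complex \<Rightarrow> real"
  assumes \<pi>: "\<pi> \<in> gauss_ints" "gauss_norm \<pi> = p" "prime p" "p \<noteq> 2" "\<pi> = of_real (sqrt (real p)) * cis \<theta>"
    and f: "continuous_on (sphere 0 1) f"
  shows "p ^ k \<in> sums_of_two_squares"
    and "(\<integral>z. f z \<partial>(lattice_measure (p ^ k))) =
      (\<Sum>l<4. (\<Sum>j\<le>k. f (\<i> ^ l * cis ((2 * real j - real k) * \<theta>))) / (4 * real (k + 1)))"
proof -
  let ?\<phi> = "\<lambda>(l, j). \<i> ^ l * (\<pi> ^ j * cnj \<pi> ^ (k - j))"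
  let ?T = "{..<4::nat} \<times> {..k}"
  have p: "real p > 0"
    using prime_gt_0_nat[OF \<pi>(3)] by simp
  have "\<pi> \<noteq> 0"
    using \<pi>(2,3) by auto
  moreover have "gauss_norm (\<pi> ^ k) = p ^ k"
    using \<pi> by (simp add: gauss_norm_power)
  ultimately show S: "p ^ k \<in> sums_of_two_squares"
    using gauss_norm_in_sums_of_two_squares[of "\<pi> ^ k"] \<pi>(1) by simp
  have bij: "bij_betw ?\<phi> ?T {z \<in> gauss_ints. gauss_norm z = p ^ k}"
    by (rule gauss_prime_power_points[OF \<pi>(1-4)])
  have val: "\<i> ^ l * (\<pi> ^ j * cnj \<pi> ^ (k - j)) / of_real (sqrt (real (p ^ k))) =
      \<i> ^ l * cis ((2 * real j - real k) * \<theta>)" if "j \<le> k" for l j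
  proof -
    have "\<pi> ^ j * cnj \<pi> ^ (k - j) = of_real (sqrt (real p) ^ j * sqrt (real p) ^ (k - j)) * (cis \<theta> ^ j * cis (- \<theta>) ^ (k - j))"
      unfolding \<pi>(5) by (simp add: power_mult_distrib cis_cnj)
    also have "sqrt (real p) ^ j * sqrt (real p) ^ (k - j) = sqrt (real (p ^ k))"
      using that by (simp add: real_sqrt_power flip: power_add)
    also have "cis \<theta> ^ j * cis (- \<theta>) ^ (k - j) = cis ((2 * real j - real k) * \<theta>)"
      unfolding Complex.DeMoivre cis_mult using that
      by (intro arg_cong[where f = cis]) (simp add: of_nat_diff algebra_simps)
    finally show ?thesis
      using p by (simp add: field_simps)
  qed
  have "card {z \<in> gauss_ints. gauss_norm z = p ^ k} = 4 * (k + 1)"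
    using bij_betw_same_card[OF bij] by (simp add: card_cartesian_product)
  moreover have "(\<Sum>z | z \<in> gauss_ints \<and> gauss_norm z = p ^ k. f (z / of_real (sqrt (real (p ^ k)))))
      = (\<Sum>l<4. \<Sum>j\<le>k. f (\<i> ^ l * cis ((2 * real j - real k) * \<theta>)))"
  proof -
    have "(\<Sum>z | z \<in> gauss_ints \<and> gauss_norm z = p ^ k. f (z / of_real (sqrt (real (p ^ k)))))
      = (\<Sum>x\<in>?T. f (?\<phi> x / of_real (sqrt (real (p ^ k)))))"
      by (rule sum.reindex_bij_betw[OF bij, symmetric])
    also have "\<dots> = (\<Sum>(l, j)\<in>?T. f (\<i> ^ l * cis ((2 * real j - real k) * \<theta>)))"
      by (rule sum.cong[OF refl]) (auto simp only: val prod.case mem_Sigma_iff atMost_iff)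
    finally show ?thesis
      by (simp add: sum.cartesian_product)
  qed
  ultimately show "(\<integral>z. f z \<partial>(lattice_measure (p ^ k))) =
      (\<Sum>l<4. (\<Sum>j\<le>k. f (\<i> ^ l * cis ((2 * real j - real k) * \<theta>))) / (4 * real (k + 1)))"
    unfolding integral_lattice_measure_gauss[OF S f] by (simp add: sum_divide_distrib)
qed

section \<open>Convergence to the arc measures and the leading constant\<close>

lemma cis_quarter_turns: "\<i> ^ l * cis t = cis (real l * pi / 2 + t)"
proof -
  have "\<i> ^ l = cis (real l * (pi / 2))"
    by (simp only: Complex.DeMoivre[symmetric] cis_pi_half)
  then show ?thesis
    by (simp add: cis_mult)
qed

text \<open>For each quarter turn \<open>l\<close> the points give a midpoint sum centred at
  \<open>l * pi / 2\<close>, with step tending to 0 and half-length tending to \<open>a\<close>; the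
  four limits, each with weight 1/4, add up to the arc measure.\<close>

lemma ex_lattice_measures_tendsto_arc:
  assumes a: "0 \<le> a"
  shows "\<exists>n :: nat \<Rightarrow> nat. (\<forall>i. n i \<in> sums_of_two_squares) \<and>
    circle_weak_conv (\<lambda>i. lattice_measure (n i)) (arc_measure a)"
proof -
  have "\<forall>i::nat. \<exists>x. case x of (p, \<pi>, \<theta>) \<Rightarrow> prime p \<and> p \<noteq> 2 \<and> \<pi> \<in> gauss_ints \<and> gauss_norm \<pi> = p \<and>
      \<pi> = of_real (sqrt (real p)) * cis \<theta> \<and> 0 < \<theta> \<and> \<theta> < 1 / real (Suc i)"
    using ex_gauss_prime_small_angle by simp
  from choice[OF this] obtain X where X: "\<forall>i. case X i of (p, \<pi>, \<theta>) \<Rightarrow> prime p \<and> p \<noteq> 2 \<and> \<pi> \<in> gauss_ints \<and> gauss_norm \<pi> = p \<and>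
      \<pi> = of_real (sqrt (real p)) * cis \<theta> \<and> 0 < \<theta> \<and> \<theta> < 1 / real (Suc i)"
    ..
  define p where "p = (\<lambda>i. fst (X i))"
  define \<pi> where "\<pi> = (\<lambda>i. fst (snd (X i)))"
  define \<theta> where "\<theta> = (\<lambda>i. snd (snd (X i)))"
  have \<pi>: "\<pi> i \<in> gauss_ints" "gauss_norm (\<pi> i) = p i" "prime (p i)" "p i \<noteq> 2"
      "\<pi> i = of_real (sqrt (real (p i))) * cis (\<theta> i)"
    and \<theta>: "0 < \<theta> i" "\<theta> i < 1 / real (Suc i)" for i
    using X[rule_format, of i] unfolding p_def \<pi>_def \<theta>_def case_prod_unfold by blast+
  have \<theta>_lim: "\<theta> \<longlonglongrightarrow> 0"
  proof (rule tendsto_sandwich[of "\<lambda>_. 0" _ _ "\<lambda>i. 1 / real (Suc i)"])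
    show "(\<lambda>i. 1 / real (Suc i)) \<longlonglongrightarrow> 0"
      using LIMSEQ_inverse_real_of_nat by (simp add: inverse_eq_divide)
  qed (intro always_eventually allI less_imp_le \<theta> tendsto_const)+
  define k where "k = (\<lambda>i. nat \<lfloor>a / \<theta> i\<rfloor>)"
  note integral = integral_lattice_measure_prime_power[OF \<pi>]
  have "circle_weak_conv (\<lambda>i. lattice_measure (p i ^ k i)) (arc_measure a)"
    unfolding circle_weak_conv_def
  proof (intro allI impI)
    fix f :: "complex \<Rightarrow> real" assume f: "continuous_on (sphere 0 1) f"
    define S where "S = (\<lambda>l i. (\<Sum>j\<le>k i. f (\<i> ^ l * cis ((2 * real j - real (k i)) * \<theta> i))) / (4 * real (k i + 1)))"
    have int: "(\<integral>z. f z \<partial>(lattice_measure (p i ^ k i))) = (\<Sum>l<4. S l i)" for i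
      unfolding integral(2)[OF f] S_def ..
    show "(\<lambda>i. \<integral>z. f z \<partial>(lattice_measure (p i ^ k i))) \<longlonglongrightarrow> (\<integral>z. f z \<partial>(arc_measure a))"
    proof (cases "a = 0")
      case True
      have meas: "f \<in> borel_measurable circle_borel"
        unfolding circle_borel_def using f by (rule borel_measurable_continuous_on_restrict)
      \<comment> \<open>Here every exponent is 0 and every chosen \<open>n\<close> is 1: the four
        units already carry the limit measure exactly.\<close>
      have "k i = 0" for i
        using True by (simp add: k_def)
      then have "S l i = f (\<i> ^ l) / 4" for l i
        by (simp add: S_def)
      then have "(\<integral>z. f z \<partial>(lattice_measure (p i ^ k i))) = (\<integral>z. f z \<partial>(arc_measure a))" for i
        unfolding int True integral_arc_measure_0[OF meas]
        by (simp only: sum_distrib_left real_scaleR_def divide_inverse_commute)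
      then show ?thesis
        by simp
    next
      case False
      then have a: "a > 0"
        using assms by simp
      have cont: "continuous_on UNIV (\<lambda>t. f (cis t))"
        by (rule continuous_on_compose2[OF f]) (auto intro!: continuous_intros)
      have "S l \<longlonglongrightarrow> integral {real l * pi / 2 - a..real l * pi / 2 + a} (\<lambda>t. f (cis t)) / (2 * a) / 4" for l
      proof -
        have "(\<lambda>i. (\<Sum>j\<le>k i. f (cis (real l * pi / 2 + (2 * real j - real (k i)) * \<theta> i))) / real (k i + 1) / 4)
            \<longlonglongrightarrow> integral {real l * pi / 2 - a..real l * pi / 2 + a} (\<lambda>t. f (cis t)) / (2 * a) / 4"
          unfolding k_def by (intro tendsto_divide tendsto_const midpoint_sums_tendsto[OF cont a \<theta>(1) \<theta>_lim]) simp
        then show ?thesis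
          unfolding S_def by (simp add: cis_quarter_turns mult.commute)
      qed
      then have "(\<lambda>i. \<Sum>l<4. S l i) \<longlonglongrightarrow>
          (\<Sum>l<4. integral {real l * pi / 2 - a..real l * pi / 2 + a} (\<lambda>t. f (cis t)) / (2 * a) / 4)"
        by (intro tendsto_sum)
      also have "(\<Sum>l<4. integral {real l * pi / 2 - a..real l * pi / 2 + a} (\<lambda>t. f (cis t)) / (2 * a) / 4)
          = (\<integral>z. f z \<partial>(arc_measure a))"
        unfolding integral_arc_measure[OF a f] by (simp add: sum_distrib_left add.commute)
      finally show ?thesis
        by (simp only: int)
    qed
  qed
  \<comment> \<open>The fact \<open>integral(1)\<close> carries a continuity premise on a test
    function that is absent from its conclusion; the zero function discharges it.\<close>
  moreover have "p i ^ k i \<in> sums_of_two_squares" for i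
    by (rule integral(1)[of "\<lambda>_. 0"]) simp
  ultimately show ?thesis
    by (intro exI[of _ "\<lambda>i. p i ^ k i"]) simp
qed

text \<open>Weak convergence is tested on real functions, so the real part has to be moved inside
  the integral.\<close>

lemma leading_const_eq_integral:
  assumes n: "n \<in> sums_of_two_squares"
  shows "leading_const n = (1 + (\<integral>z. Re (z powi (- 4)) \<partial>(lattice_measure n))\<^sup>2) / 512"
proof -
  have cont: "continuous_on (sphere 0 1) (\<lambda>z::complex. z powi (- 4))"
    by (auto intro!: continuous_intros)
  have "(\<lambda>z. z powi (- 4)) \<in> borel_measurable circle_borel" "(\<lambda>z. Re (z powi (- 4))) \<in> borel_measurable circle_borel"
    unfolding circle_borel_def using cont
    by (auto intro!: borel_measurable_continuous_on_restrict continuous_on_Re)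
  from this[THEN integral_lattice_measure[OF n]]
  have "Re (fourier_coeff (lattice_measure n) 4) = (\<integral>z. Re (z powi (- 4)) \<partial>(lattice_measure n))"
    unfolding fourier_coeff_def by (simp only: scaleR_complex.sel Re_sum case_prod_unfold real_scaleR_def)
  then show ?thesis
    by (simp add: leading_const_def)
qed

text \<open>On the circle the integrand is cos(4t), of period pi/2, so each of the four arcs
  contributes \<open>sin (4 * a) / 2\<close>; dividing the total by \<open>8 * a\<close> gives the
  quotient sin(4a)/(4a). The value 1 of \<open>sinc\<close> at 0 covers the four point
  masses.\<close>

lemma integral_arc_measure_character:
  assumes a: "0 \<le> a"
  shows "(\<integral>z. Re (z powi (- 4)) \<partial>(arc_measure a)) = sinc (4 * a)"
proof -
  let ?f = "\<lambda>z::complex. Re (z powi (- 4))"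
  have cont: "continuous_on (sphere 0 1) ?f"
    by (auto intro!: continuous_intros)
  show ?thesis
  proof (cases "a = 0")
    case True
    have "?f \<in> borel_measurable circle_borel"
      unfolding circle_borel_def using cont by (rule borel_measurable_continuous_on_restrict)
    moreover have "(\<i> ^ k) powi (- 4) = 1" for k
    proof -
      have "(\<i> ^ k) ^ 4 = (\<i> ^ 4) ^ k"
        by (simp only: power_mult[symmetric] mult.commute)
      also have "\<dots> = 1"
        by (simp add: power4_eq_xxxx)
      finally show ?thesis
        by (simp add: power_int_minus)
    qed
    ultimately show ?thesis
      unfolding True by (subst integral_arc_measure_0) simp_all
  next
    case False
    then have a: "a > 0"
      using assms by simp
    have cis4: "?f (cis t) = cos (4 * t)" for t
      by (simp add: power_int_minus Complex.DeMoivre cis_inverse)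
    have arc: "integral {- a + real l * pi / 2..a + real l * pi / 2} (\<lambda>t. cos (4 * t)) = sin (4 * a) / 2" for l :: nat
    proof -
      have "((\<lambda>t. cos (4 * t)) has_integral
          sin (4 * (a + real l * pi / 2)) / 4 - sin (4 * (- a + real l * pi / 2)) / 4)
          {- a + real l * pi / 2..a + real l * pi / 2}"
      proof (rule fundamental_theorem_of_calculus)
        show "((\<lambda>t. sin (4 * t) / 4) has_vector_derivative cos (4 * t))
            (at t within {- a + real l * pi / 2..a + real l * pi / 2})" for t
          unfolding has_real_derivative_iff_has_vector_derivative[symmetric]
          by (auto intro!: derivative_eq_intros)
      qed (use a in simp)
      moreover have "sin (4 * (x + real l * pi / 2)) = sin (4 * x)" for x
      proof -
        have "4 * (x + real l * pi / 2) = 4 * x + 2 * pi * of_int (int l)"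
          by (simp add: algebra_simps)
        then show ?thesis
          by (simp only: sin_int_2pin cos_int_2pin sin_add mult_1_right mult_zero_right add_0_right)
      qed
      ultimately have "((\<lambda>t. cos (4 * t)) has_integral sin (4 * a) / 4 - sin (4 * (- a)) / 4)
          {- a + real l * pi / 2..a + real l * pi / 2}"
        by (simp only:)
      then show ?thesis
        by (auto dest!: integral_unique)
    qed
    show ?thesis
      unfolding integral_arc_measure[OF a cont] cis4 arc using a by simp
  qed
qed

theorem proposition1p2:
  shows "(\<forall>a :: real. 0 \<le> a \<and> a \<le> pi / 4 \<longrightarrow>
            (\<exists>n :: nat \<Rightarrow> nat. (\<forall>i. n i \<in> sums_of_two_squares) \<and>
               circle_weak_conv (\<lambda>i. lattice_measure (n i)) (arc_measure a))) \<and>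
         (\<forall>b :: real. 0 \<le> b \<and> b \<le> 1 \<longrightarrow>
            (\<exists>n :: nat \<Rightarrow> nat. (\<forall>i. n i \<in> sums_of_two_squares) \<and>
               (\<lambda>i. leading_const (n i)) \<longlonglongrightarrow> (1 + b) / 512))"
proof (intro conjI allI impI)
  fix a :: real assume "0 \<le> a \<and> a \<le> pi / 4"
  then show "\<exists>n :: nat \<Rightarrow> nat. (\<forall>i. n i \<in> sums_of_two_squares) \<and>
      circle_weak_conv (\<lambda>i. lattice_measure (n i)) (arc_measure a)"
    by (intro ex_lattice_measures_tendsto_arc) simp
next
  fix b :: real assume b: "0 \<le> b \<and> b \<le> 1"
  have "continuous_on UNIV sinc"
    by (intro continuous_at_imp_continuous_on ballI isCont_sinc)
  then have "continuous_on {0..pi / 4} (\<lambda>a. sinc (4 * a))"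
    by (rule continuous_on_compose2) (intro continuous_intros, simp)
  then have cont: "continuous_on {0..pi / 4} (\<lambda>a. (sinc (4 * a))\<^sup>2)"
    by (rule continuous_on_power)
  \<comment> \<open>The square falls from 1 at 0 to 0 at pi/4, where sin(4a) = sin(pi) = 0, so it
    takes every value in between.\<close>
  have "\<exists>a\<ge>0. a \<le> pi / 4 \<and> (sinc (4 * a))\<^sup>2 = b"
    by (rule IVT2'[OF _ _ _ cont]) (use b in simp_all)
  then obtain a where a: "0 \<le> a" "(sinc (4 * a))\<^sup>2 = b"
    by blast
  obtain n :: "nat \<Rightarrow> nat" where n: "\<And>i. n i \<in> sums_of_two_squares"
      "circle_weak_conv (\<lambda>i. lattice_measure (n i)) (arc_measure a)"
    using ex_lattice_measures_tendsto_arc[OF a(1)] by blast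
  have "continuous_on (sphere 0 1) (\<lambda>z::complex. Re (z powi (- 4)))"
    by (auto intro!: continuous_intros)
  then have "(\<lambda>i. \<integral>z. Re (z powi (- 4)) \<partial>(lattice_measure (n i))) \<longlonglongrightarrow> sinc (4 * a)"
    using n(2) unfolding circle_weak_conv_def integral_arc_measure_character[OF a(1), symmetric] by blast
  then have "(\<lambda>i. (1 + (\<integral>z. Re (z powi (- 4)) \<partial>(lattice_measure (n i)))\<^sup>2) / 512) \<longlonglongrightarrow> (1 + (sinc (4 * a))\<^sup>2) / 512"
    by (intro tendsto_intros) auto
  then have "(\<lambda>i. leading_const (n i)) \<longlonglongrightarrow> (1 + b) / 512"
    by (simp only: leading_const_eq_integral[OF n(1)] a(2))
  then show "\<exists>n :: nat \<Rightarrow> nat. (\<forall>i. n i \<in> sums_of_two_squares) \<and>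
      (\<lambda>i. leading_const (n i)) \<longlonglongrightarrow> (1 + b) / 512"
    using n(1) by blast
qed

end
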